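(* Let $V$ be a complex vector space with $\dim V=k$. The space $(V^{\otimes p}\otimes V^{*\otimes q})^{\mathrm{GL}(V)}$ is nonzero if and only if $p=q$. In this case, a basis for $(V^{\otimes p}\otimes V^{*\otimes p})^{\mathrm{GL}(V)}$ is given by the set of all 1-regular $(p,p)$-bipartite arc diagrams such that no strict nesting contains more than $k$ arcs. Here, identifying $V^{\otimes p}\otimes V^{*\otimes p}$ with the space of multilinear forms on $V^{*p}\oplus V^p$, each arc $(i^*,j)$ is interpreted as the contraction $f_{ij}$, and a diagram as the product of its arcs.
   Context: For $(v_1^*,\dots,v_p^*,v_1,\dots,v_p)\in V^{*p}\oplus V^p$, $f_{ij}(v_1^*,\dots,v_p^*,v_1,\dots,v_p)=v_i^*(v_j)$. A $(p,p)$-bipartite arc diagram is a bipartite multigraph on vertices $1^*,\dots,p^*,1,\dots,p$, drawn from left to right in this order, in which every edge (arc) joins a starred vertex $i^*$ to an unstarred vertex $j$. It is 1-regular if every vertex has degree 1. A strict nesting is a set of arcs that are pairwise strictly nested, where $(i^*,j)$ and $(i'^*,j')$ are strictly nested if $i<i'$ and $j>j'$, or $i>i'$ and $j<j'$.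
   Formalization: The claim that the space is nonzero if and only if p = q is stated only for k ≥ 1, since it fails for V = 0 and p = q > 0; the basis claim is stated for all k ≥ 0. *)

theory Defs
  imports Complex_Main "HOL-Library.FuncSet" "HOL-Library.Multiset" "HOL-Library.Function_Algebras"
begin

section \<open>Tensors as multilinear forms\<close>

text \<open>
  A complex vector space is given by its scalar multiplication \<open>scale\<close> on a type \<open>'v\<close>.
  Tuples of length \<open>p\<close> are functions on \<open>nat\<close> that are extensional on \<open>{1..p}\<close>.
\<close>

definition dual :: "(complex \<Rightarrow> 'v::ab_group_add \<Rightarrow> 'v) \<Rightarrow> ('v \<Rightarrow> complex) set" where
  "dual scale = {f. Vector_Spaces.linear scale (*) f}"

definition GL :: "(complex \<Rightarrow> 'v::ab_group_add \<Rightarrow> 'v) \<Rightarrow> ('v \<Rightarrow> 'v) set" where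
  "GL scale = {g. Vector_Spaces.linear scale scale g \<and> bij g}"

text \<open>The domain \<open>V\<^sup>*\<^sup>p \<oplus> V\<^sup>q\<close>.\<close>

type_synonym 'v args = "(nat \<Rightarrow> 'v \<Rightarrow> complex) \<times> (nat \<Rightarrow> 'v)"

definition args ::
    "(complex \<Rightarrow> 'v::ab_group_add \<Rightarrow> 'v) \<Rightarrow> nat \<Rightarrow> nat \<Rightarrow> 'v args set" where
  "args scale p q = ({1..p} \<rightarrow>\<^sub>E dual scale) \<times> ({1..q} \<rightarrow>\<^sub>E UNIV)"

text \<open>
  Linearity in each of the \<open>p + q\<close> slots separately.  The covector slots range over the
  set \<open>dual scale\<close> rather than over a type, so linearity in them is spelled out.
\<close>

definition multilinear_map ::
    "(complex \<Rightarrow> 'v::ab_group_add \<Rightarrow> 'v) \<Rightarrow> (complex \<Rightarrow> 'w::ab_group_add \<Rightarrow> 'w)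
     \<Rightarrow> nat \<Rightarrow> nat \<Rightarrow> ('v args \<Rightarrow> 'w) \<Rightarrow> bool" where
  "multilinear_map scale s p q m \<longleftrightarrow>
     (\<forall>\<alpha> w. (\<alpha>, w) \<in> args scale p q \<longrightarrow>
        (\<forall>i\<in>{1..p}. \<forall>a\<in>dual scale. \<forall>b\<in>dual scale. \<forall>c.
            m (\<alpha>(i := \<lambda>x. a x + b x), w) = m (\<alpha>(i := a), w) + m (\<alpha>(i := b), w) \<and>
            m (\<alpha>(i := \<lambda>x. c * a x), w) = s c (m (\<alpha>(i := a), w))) \<and>
        (\<forall>j\<in>{1..q}. Vector_Spaces.linear scale s (\<lambda>x. m (\<alpha>, w(j := x)))))"

text \<open>
  Functions on \<open>V\<^sup>*\<^sup>p \<oplus> V\<^sup>q\<close> are represented by functions on the whole type that vanish outside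
  \<open>args scale p q\<close>; they form a complex vector space under pointwise operations.
\<close>

definition form_scale :: "complex \<Rightarrow> ('a \<Rightarrow> complex) \<Rightarrow> 'a \<Rightarrow> complex" where
  "form_scale c F = (\<lambda>x. c * F x)"

definition multilinear_forms ::
    "(complex \<Rightarrow> 'v::ab_group_add \<Rightarrow> 'v) \<Rightarrow> nat \<Rightarrow> nat \<Rightarrow> ('v args \<Rightarrow> complex) set" where
  "multilinear_forms scale p q =
     {F. multilinear_map scale (*) p q F \<and> (\<forall>x. x \<notin> args scale p q \<longrightarrow> F x = 0)}"

text \<open>
  The elementary tensor \<open>u\<^sub>1 \<otimes> \<dots> \<otimes> u\<^sub>p \<otimes> \<phi>\<^sub>1 \<otimes> \<dots> \<otimes> \<phi>\<^sub>q\<close>, viewed as the form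
  \<open>(\<alpha>, w) \<mapsto> \<alpha>\<^sub>1(u\<^sub>1) \<cdots> \<alpha>\<^sub>p(u\<^sub>p) \<phi>\<^sub>1(w\<^sub>1) \<cdots> \<phi>\<^sub>q(w\<^sub>q)\<close>.
\<close>

definition tensor ::
    "(complex \<Rightarrow> 'v::ab_group_add \<Rightarrow> 'v) \<Rightarrow> nat \<Rightarrow> nat
     \<Rightarrow> (nat \<Rightarrow> 'v) \<Rightarrow> (nat \<Rightarrow> 'v \<Rightarrow> complex) \<Rightarrow> 'v args \<Rightarrow> complex" where
  "tensor scale p q u \<phi> =
     (\<lambda>(\<alpha>, w). if (\<alpha>, w) \<in> args scale p q
               then (\<Prod>i=1..p. \<alpha> i (u i)) * (\<Prod>j=1..q. \<phi> j (w j)) else 0)"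

text \<open>
  \<open>V\<^sup>\<otimes>\<^sup>p \<otimes> V\<^sup>*\<^sup>\<otimes>\<^sup>q\<close>.  For finite-dimensional \<open>V\<close> this is the space of all multilinear
  forms, and it has the universal property of the tensor product (lemmas
  \<open>tensor_space_eq_multilinear_forms\<close> and \<open>tensor_space_universal\<close> below).
\<close>

definition tensor_space ::
    "(complex \<Rightarrow> 'v::ab_group_add \<Rightarrow> 'v) \<Rightarrow> nat \<Rightarrow> nat \<Rightarrow> ('v args \<Rightarrow> complex) set" where
  "tensor_space scale p q =
     module.span form_scale {tensor scale p q u \<phi> | u \<phi>. (\<phi>, u) \<in> args scale q p}"

text \<open>
  The action \<open>(g \<cdot> F)(\<alpha>, w) = F(\<alpha> \<circ> g, g\<^sup>-\<^sup>1 w)\<close>, which on elementary tensors is the diagonal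
  action \<open>u\<^sub>i \<mapsto> g u\<^sub>i\<close>, \<open>\<phi>\<^sub>j \<mapsto> \<phi>\<^sub>j \<circ> g\<^sup>-\<^sup>1\<close> (lemma \<open>gl_act_tensor\<close>).
\<close>

definition gl_act ::
    "(complex \<Rightarrow> 'v::ab_group_add \<Rightarrow> 'v) \<Rightarrow> nat \<Rightarrow> nat \<Rightarrow> ('v \<Rightarrow> 'v)
     \<Rightarrow> ('v args \<Rightarrow> complex) \<Rightarrow> 'v args \<Rightarrow> complex" where
  "gl_act scale p q g F =
     (\<lambda>(\<alpha>, w). if (\<alpha>, w) \<in> args scale p q
               then F (\<lambda>i\<in>{1..p}. \<alpha> i \<circ> g, \<lambda>j\<in>{1..q}. inv g (w j)) else 0)"

definition gl_invariants ::
    "(complex \<Rightarrow> 'v::ab_group_add \<Rightarrow> 'v) \<Rightarrow> nat \<Rightarrow> nat \<Rightarrow> ('v args \<Rightarrow> complex) set" where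
  "gl_invariants scale p q =
     {F \<in> tensor_space scale p q. \<forall>g\<in>GL scale. gl_act scale p q g F = F}"

section \<open>Bipartite arc diagrams\<close>

text \<open>
  The pair \<open>(i, j)\<close> stands for the arc from \<open>i\<^sup>*\<close> to \<open>j\<close>, and a bipartite multigraph is its
  multiset of arcs.
\<close>

type_synonym arc = "nat \<times> nat"

definition arc_diagrams :: "nat \<Rightarrow> arc multiset set" where
  "arc_diagrams p = {D. set_mset D \<subseteq> {1..p} \<times> {1..p}}"

definition one_regular :: "nat \<Rightarrow> arc multiset \<Rightarrow> bool" where
  "one_regular p D \<longleftrightarrow>
     (\<forall>i\<in>{1..p}. size {#a \<in># D. fst a = i#} = 1) \<and>
     (\<forall>j\<in>{1..p}. size {#a \<in># D. snd a = j#} = 1)"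

definition strictly_nested :: "arc \<Rightarrow> arc \<Rightarrow> bool" where
  "strictly_nested a b \<longleftrightarrow>
     (fst a < fst b \<and> snd a > snd b) \<or> (fst a > fst b \<and> snd a < snd b)"

definition strict_nesting :: "arc multiset \<Rightarrow> arc set \<Rightarrow> bool" where
  "strict_nesting D S \<longleftrightarrow>
     S \<subseteq> set_mset D \<and> (\<forall>a\<in>S. \<forall>b\<in>S. a \<noteq> b \<longrightarrow> strictly_nested a b)"

definition nesting_bounded_diagrams :: "nat \<Rightarrow> nat \<Rightarrow> arc multiset set" where
  "nesting_bounded_diagrams k p =
     {D \<in> arc_diagrams p. one_regular p D \<and> (\<forall>S. strict_nesting D S \<longrightarrow> card S \<le> k)}"

definition contraction :: "nat \<Rightarrow> nat \<Rightarrow> 'v args \<Rightarrow> complex" where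
  "contraction i j = (\<lambda>(\<alpha>, w). \<alpha> i (w j))"

definition diagram_form ::
    "(complex \<Rightarrow> 'v::ab_group_add \<Rightarrow> 'v) \<Rightarrow> nat \<Rightarrow> arc multiset \<Rightarrow> 'v args \<Rightarrow> complex" where
  "diagram_form scale p D =
     (\<lambda>x. if x \<in> args scale p p then \<Prod>(i, j)\<in>#D. contraction i j x else 0)"

section \<open>The tensor space has the expected properties\<close>

lemma vector_space_form_scale: "vector_space (form_scale :: complex \<Rightarrow> ('a \<Rightarrow> complex) \<Rightarrow> _)"
  by unfold_locales (auto simp: form_scale_def fun_eq_iff algebra_simps)

interpretation form: vector_space "form_scale :: complex \<Rightarrow> ('a \<Rightarrow> complex) \<Rightarrow> _"
  by (rule vector_space_form_scale)

lemma dual_compose: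
  assumes "\<alpha> \<in> dual scale" "Vector_Spaces.linear scale scale g"
  shows "\<alpha> \<circ> g \<in> dual scale"
  using assms unfolding dual_def
  by (auto simp: Vector_Spaces.linear_iff)

lemma GL_inv_linear:
  assumes "g \<in> GL scale"
  shows "Vector_Spaces.linear scale scale (inv g)"
proof -
  have g: "Vector_Spaces.linear scale scale g" "bij g" using assms by (auto simp: GL_def)
  interpret g: Vector_Spaces.linear scale scale g by (rule g(1))
  have gi: "g (inv g x) = x" for x using g(2) by (simp add: bij_is_surj surj_f_inv_f)
  have ig: "inv g (g x) = x" for x using g(2) by (simp add: bij_is_inj)
  have "inv g (x + y) = inv g x + inv g y" for x y
    by (metis g.add gi ig)
  moreover have "inv g (scale c x) = scale c (inv g x)" for c x
    by (metis g.scale gi ig)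
  ultimately show ?thesis
    using g(1) by (auto simp: Vector_Spaces.linear_iff)
qed

lemma gl_act_tensor:
  assumes "g \<in> GL scale"
  shows "gl_act scale p q g (tensor scale p q u \<phi>) =
         tensor scale p q (\<lambda>i. g (u i)) (\<lambda>j. \<phi> j \<circ> inv g)"
proof (rule ext, clarify)
  fix \<alpha> w
  have "(\<lambda>i\<in>{1..p}. \<alpha> i \<circ> g, \<lambda>j\<in>{1..q}. inv g (w j)) \<in> args scale p q"
    if "(\<alpha>, w) \<in> args scale p q"
    using that assms by (auto simp: args_def GL_def intro!: dual_compose)
  then show "gl_act scale p q g (tensor scale p q u \<phi>) (\<alpha>, w) =
         tensor scale p q (\<lambda>i. g (u i)) (\<lambda>j. \<phi> j \<circ> inv g) (\<alpha>, w)"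
    by (auto simp: gl_act_def tensor_def)
qed

lemma sum_fun_apply: "sum f A x = (\<Sum>a\<in>A. f a x)" for f :: "'a \<Rightarrow> 'b \<Rightarrow> complex"
  by (induction A rule: infinite_finite_induct) auto

lemma slotwise_expansion:
  fixes s :: "complex \<Rightarrow> 'w::ab_group_add \<Rightarrow> 'w" and h :: "('i \<Rightarrow> 'x) \<Rightarrow> 'w"
  assumes s: "vector_space s" and "finite I" "finite B"
    and step: "\<And>y i. i \<in> I \<Longrightarrow> (\<And>j. j \<in> I \<Longrightarrow> y j = x j \<or> y j \<in> E ` B) \<Longrightarrow>
                 (\<And>j. j \<notin> I \<Longrightarrow> y j = x j) \<Longrightarrow> y i = x i \<Longrightarrow>
                 h y = (\<Sum>b\<in>B. s (c i b) (h (y(i := E b))))"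
  shows "h x = (\<Sum>f\<in>I \<rightarrow>\<^sub>E B. s (\<Prod>i\<in>I. c i (f i)) (h (\<lambda>i. if i \<in> I then E (f i) else x i)))"
proof -
  interpret s: vector_space s by (rule s)
  have "h x = (\<Sum>f\<in>J \<rightarrow>\<^sub>E B. s (\<Prod>i\<in>J. c i (f i)) (h (\<lambda>i. if i \<in> J then E (f i) else x i)))"
    if "J \<subseteq> I" for J
    using finite_subset[OF that \<open>finite I\<close>] that
  proof (induction J rule: finite_induct)
    case empty
    then show ?case by simp
  next
    case (insert i J)
    let ?y = "\<lambda>f i. if i \<in> J then E (f i) else x i"
    have "h x = (\<Sum>f\<in>J \<rightarrow>\<^sub>E B. s (\<Prod>i\<in>J. c i (f i)) (h (?y f)))"
      using insert by simp
    also have "\<dots> = (\<Sum>f\<in>J \<rightarrow>\<^sub>E B. s (\<Prod>i\<in>J. c i (f i)) (\<Sum>b\<in>B. s (c i b) (h ((?y f)(i := E b)))))"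
      using insert.hyps insert.prems by (intro sum.cong refl arg_cong[where f="s _"] step) auto
    also have "\<dots> = (\<Sum>f\<in>J \<rightarrow>\<^sub>E B. \<Sum>b\<in>B. s (c i b * (\<Prod>i\<in>J. c i (f i))) (h ((?y f)(i := E b))))"
      by (simp add: s.scale_sum_right mult.commute)
    also have "\<dots> = (\<Sum>(b, f)\<in>B \<times> (J \<rightarrow>\<^sub>E B).
                      s (c i b * (\<Prod>i\<in>J. c i (f i))) (h ((?y f)(i := E b))))"
      by (subst sum.swap) (simp add: sum.cartesian_product)
    also have "\<dots> = (\<Sum>f\<in>insert i J \<rightarrow>\<^sub>E B.
            s (\<Prod>i\<in>insert i J. c i (f i)) (h (\<lambda>j. if j \<in> insert i J then E (f j) else x j)))"
    proof -
      have inj: "inj_on (\<lambda>(b, f). f(i := b)) (B \<times> (J \<rightarrow>\<^sub>E B))"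
        using insert.hyps by (intro inj_combinator)
      show ?thesis
        unfolding PiE_insert_eq sum.reindex[OF inj]
      proof (rule sum.cong[OF refl], unfold comp_def, clarify)
        fix b f
        have "(\<Prod>j\<in>J. c j ((f(i := b)) j)) = (\<Prod>j\<in>J. c j (f j))"
          using insert.hyps by (intro prod.cong) auto
        then have 1: "(\<Prod>j\<in>insert i J. c j ((f(i := b)) j)) = c i b * (\<Prod>j\<in>J. c j (f j))"
          using insert.hyps by simp
        have 2: "(\<lambda>j. if j \<in> insert i J then E ((f(i := b)) j) else x j) = (?y f)(i := E b)"
          by auto
        show "s (c i b * (\<Prod>j\<in>J. c j (f j))) (h ((?y f)(i := E b))) =
              s (\<Prod>j\<in>insert i J. c j ((f(i := b)) j))
                (h (\<lambda>j. if j \<in> insert i J then E ((f(i := b)) j) else x j))"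
          unfolding 1 2 ..
      qed
    qed
    finally show ?case .
  qed
  from this[of I] show ?thesis by simp
qed

context finite_dimensional_vector_space
begin

lemma coordinate_linear: "Vector_Spaces.linear scale (*) (\<lambda>v. representation Basis v b)"
  by (rule linear_representation) (auto simp: independent_Basis span_Basis)

end

lemma multilinear_map_expansion:
  fixes scale :: "complex \<Rightarrow> 'v::ab_group_add \<Rightarrow> 'v" and s :: "complex \<Rightarrow> 'w::ab_group_add \<Rightarrow> 'w"
  assumes fd: "finite_dimensional_vector_space scale B"
    and s: "vector_space s"
    and m: "multilinear_map scale s p q m"
    and x: "(\<alpha>, w) \<in> args scale p q"
  defines "e \<equiv> \<lambda>b v. module.representation scale B v b"
  shows "m (\<alpha>, w) = (\<Sum>f\<in>{1..p} \<rightarrow>\<^sub>E B. \<Sum>g\<in>{1..q} \<rightarrow>\<^sub>E B.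
           s ((\<Prod>i=1..p. \<alpha> i (f i)) * (\<Prod>j=1..q. e (g j) (w j)))
             (m (\<lambda>i\<in>{1..p}. e (f i), g)))"
proof -
  interpret V: finite_dimensional_vector_space scale B by (rule fd)
  interpret s: vector_space s by (rule s)
  have e_dual: "e b \<in> dual scale" for b
    unfolding dual_def e_def using V.coordinate_linear by simp
  have expand_v: "v = (\<Sum>b\<in>B. scale (e b v) b)" for v
    unfolding e_def
    by (rule V.sum_representation_eq[symmetric])
       (auto simp: V.independent_Basis V.span_Basis V.finite_Basis)
  have dual_sum: "(\<lambda>x. \<Sum>b\<in>C. d b * e b x) \<in> dual scale" for C d
  proof (induction C rule: infinite_finite_induct)
    case (insert b C)
    then show ?case using e_dual[of b]
      by (auto simp: dual_def Vector_Spaces.linear_iff algebra_simps)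
  qed (auto simp: dual_def Vector_Spaces.linear_iff V.vector_space_axioms
         intro: vector_space.intro simp: algebra_simps vector_space_def)
  have dual_scaled: "(\<lambda>x. c * e b x) \<in> dual scale" for c b
    using dual_sum[of "\<lambda>_. c" "{b}"] by simp
  have expand_dual: "a = (\<lambda>x. \<Sum>b\<in>B. a b * e b x)" if "a \<in> dual scale" for a
  proof
    fix x
    interpret a: Vector_Spaces.linear scale "(*)" a using that by (simp add: dual_def)
    have "a x = a (\<Sum>b\<in>B. scale (e b x) b)" unfolding expand_v[symmetric] ..
    also have "\<dots> = (\<Sum>b\<in>B. a b * e b x)"
      unfolding a.sum by (simp add: a.scale mult.commute)
    finally show "a x = (\<Sum>b\<in>B. a b * e b x)" .
  qed
  have m_add: "m (\<beta>(i := \<lambda>x. a x + b x), w) = m (\<beta>(i := a), w) + m (\<beta>(i := b), w)"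
    if "(\<beta>, w) \<in> args scale p q" "i \<in> {1..p}" "a \<in> dual scale" "b \<in> dual scale" for \<beta> w i a b
    using m that unfolding multilinear_map_def by blast
  have m_zero: "m (\<beta>(i := \<lambda>_. 0), w) = 0"
    if "(\<beta>, w) \<in> args scale p q" "i \<in> {1..p}" for \<beta> w i
  proof -
    have "m (\<beta>(i := \<lambda>x. 0 * e b x), w) = s 0 (m (\<beta>(i := e b), w))" for b
      using m that e_dual unfolding multilinear_map_def by blast
    then show ?thesis by simp
  qed
  have m_sum: "m (\<beta>(i := \<lambda>x. \<Sum>b\<in>C. d b * e b x), w) = (\<Sum>b\<in>C. s (d b) (m (\<beta>(i := e b), w)))"
    if "(\<beta>, w) \<in> args scale p q" "i \<in> {1..p}" "finite C" for \<beta> w i C d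
    using that(3)
  proof (induction C rule: finite_induct)
    case empty
    then show ?case using m_zero[OF that(1,2)] by (simp del: fun_upd_apply)
  next
    case (insert b C)
    have "m (\<beta>(i := \<lambda>x. d b * e b x + (\<Sum>b\<in>C. d b * e b x)), w) =
          m (\<beta>(i := \<lambda>x. d b * e b x), w) + m (\<beta>(i := \<lambda>x. \<Sum>b\<in>C. d b * e b x), w)"
      by (rule m_add[OF that(1,2) dual_scaled dual_sum])
    moreover have "m (\<beta>(i := \<lambda>x. d b * e b x), w) = s (d b) (m (\<beta>(i := e b), w))"
      using m that(1,2) e_dual unfolding multilinear_map_def by blast
    ultimately show ?case using insert by (simp del: fun_upd_apply)
  qed
  have 1: "m (\<alpha>, w) = (\<Sum>f\<in>{1..p} \<rightarrow>\<^sub>E B. s (\<Prod>i=1..p. \<alpha> i (f i))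
             (m (\<lambda>i. if i \<in> {1..p} then e (f i) else \<alpha> i, w)))"
  proof (rule slotwise_expansion[OF s, where h = "\<lambda>\<beta>. m (\<beta>, w)" and c = "\<lambda>i. \<alpha> i"])
    fix y i
    assume i: "i \<in> {1..p}" and y1: "\<And>j. j \<in> {1..p} \<Longrightarrow> y j = \<alpha> j \<or> y j \<in> e ` B"
      and y2: "\<And>j. j \<notin> {1..p} \<Longrightarrow> y j = \<alpha> j" and yi: "y i = \<alpha> i"
    have y: "(y, w) \<in> args scale p q"
    proof -
      have "y j \<in> dual scale" if "j \<in> {1..p}" for j
        using y1[OF that] x that e_dual by (auto simp: args_def)
      moreover have "y j = undefined" if "j \<notin> {1..p}" for j
        using y2[OF that] x that by (auto simp: args_def PiE_iff extensional_def)
      ultimately show ?thesis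
        using x by (auto simp: args_def PiE_iff extensional_def)
    qed
    have ai: "\<alpha> i \<in> dual scale" using x i by (auto simp: args_def)
    have "y(i := \<lambda>x. \<Sum>b\<in>B. \<alpha> i b * e b x) = y"
      unfolding expand_dual[OF ai, symmetric] using yi by auto
    then show "m (y, w) = (\<Sum>b\<in>B. s (\<alpha> i b) (m (y(i := e b), w)))"
      unfolding m_sum[OF y i V.finite_Basis, symmetric] by (simp only:)
  qed (use V.finite_Basis in auto)
  have 2: "m (\<beta>, w) = (\<Sum>g\<in>{1..q} \<rightarrow>\<^sub>E B. s (\<Prod>j=1..q. e (g j) (w j))
             (m (\<beta>, \<lambda>j. if j \<in> {1..q} then g j else w j)))"
    if \<beta>: "(\<beta>, w) \<in> args scale p q" for \<beta>
  proof (rule slotwise_expansion[OF s, where h = "\<lambda>w. m (\<beta>, w)" and c = "\<lambda>j b. e b (w j)"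
        and E = "\<lambda>b. b"])
    fix y j
    assume j: "j \<in> {1..q}" and y1: "\<And>i. i \<in> {1..q} \<Longrightarrow> y i = w i \<or> y i \<in> (\<lambda>b. b) ` B"
      and y2: "\<And>i. i \<notin> {1..q} \<Longrightarrow> y i = w i" and yj: "y j = w j"
    have y: "(\<beta>, y) \<in> args scale p q"
      using \<beta> y2 by (auto simp: args_def PiE_iff extensional_def)
    then have "Vector_Spaces.linear scale s (\<lambda>x. m (\<beta>, y(j := x)))"
      using m j unfolding multilinear_map_def by blast
    then interpret l: Vector_Spaces.linear scale s "\<lambda>x. m (\<beta>, y(j := x))" .
    have "m (\<beta>, y) = m (\<beta>, y(j := w j))" using yj by (metis fun_upd_triv)
    also have "\<dots> = m (\<beta>, y(j := \<Sum>b\<in>B. scale (e b (w j)) b))"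
      unfolding expand_v[symmetric] ..
    also have "\<dots> = (\<Sum>b\<in>B. s (e b (w j)) (m (\<beta>, y(j := b))))"
      unfolding l.sum l.scale ..
    finally show "m (\<beta>, y) = (\<Sum>b\<in>B. s (e b (w j)) (m (\<beta>, y(j := b))))" .
  qed (use V.finite_Basis in auto)
  have r1: "(\<lambda>i. if i \<in> {1..p} then e (f i) else \<alpha> i) = (\<lambda>i\<in>{1..p}. e (f i))" for f :: "nat \<Rightarrow> 'v"
    using x by (auto simp: args_def PiE_iff extensional_def restrict_def fun_eq_iff)
  have r2: "(\<lambda>j. if j \<in> {1..q} then g j else w j) = g" if "g \<in> {1..q} \<rightarrow>\<^sub>E B" for g
    using x that by (auto simp: args_def PiE_iff extensional_def fun_eq_iff)
  have mem: "(\<lambda>i\<in>{1..p}. e (f i), w) \<in> args scale p q" for f :: "nat \<Rightarrow> 'v"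
    using x e_dual by (auto simp: args_def)
  have "m (\<lambda>i\<in>{1..p}. e (f i), w) = (\<Sum>g\<in>{1..q} \<rightarrow>\<^sub>E B. s (\<Prod>j=1..q. e (g j) (w j))
          (m (\<lambda>i\<in>{1..p}. e (f i), g)))" for f :: "nat \<Rightarrow> 'v"
    unfolding 2[OF mem] by (intro sum.cong refl) (simp only: r2)
  then show ?thesis
    unfolding 1 r1 by (simp only: s.scale_sum_right s.scale_scale)
qed

lemma multilinear_forms_subspace:
  fixes scale :: "complex \<Rightarrow> 'v::ab_group_add \<Rightarrow> 'v"
  assumes "vector_space scale"
  shows "form.subspace (multilinear_forms scale p q)"
proof -
  have "vector_space ((*) :: complex \<Rightarrow> complex \<Rightarrow> complex)"
    by unfold_locales (auto simp: algebra_simps)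
  then show ?thesis
    using assms
    by (auto simp: form.subspace_def multilinear_forms_def multilinear_map_def form_scale_def
          Vector_Spaces.linear_iff algebra_simps)
qed

lemma prod_upd_slot:
  fixes f :: "nat \<Rightarrow> 'a \<Rightarrow> complex"
  assumes "i \<in> {1..p}"
  shows "(\<Prod>k=1..p. f k ((\<alpha>(i := a)) k)) = f i a * (\<Prod>k\<in>{1..p}-{i}. f k (\<alpha> k))"
proof -
  have "(\<Prod>k\<in>{1..p}-{i}. f k ((\<alpha>(i := a)) k)) = (\<Prod>k\<in>{1..p}-{i}. f k (\<alpha> k))"
    by (intro prod.cong) auto
  then show ?thesis using assms by (subst prod.remove[of _ i]) auto
qed

lemma tensor_in_multilinear_forms:
  fixes scale :: "complex \<Rightarrow> 'v::ab_group_add \<Rightarrow> 'v"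
  assumes "(\<phi>, u) \<in> args scale q p"
  shows "tensor scale p q u \<phi> \<in> multilinear_forms scale p q"
proof -
  have vs: "Vector_Spaces.linear scale (*) (\<phi> j)" if "j \<in> {1..q}" for j
    using assms that by (auto simp: args_def dual_def)
  have dual_add: "(\<lambda>x. a x + b x) \<in> dual scale" "(\<lambda>x. c * a x) \<in> dual scale"
    if "a \<in> dual scale" "b \<in> dual scale" for a b c
    using that by (auto simp: dual_def Vector_Spaces.linear_iff algebra_simps)
  have upd1: "(\<alpha>(i := a), w) \<in> args scale p q"
    if "(\<alpha>, w) \<in> args scale p q" "i \<in> {1..p}" "a \<in> dual scale" for \<alpha> w i a
    using that by (auto simp: args_def PiE_iff extensional_def)
  have upd2: "(\<alpha>, w(j := v)) \<in> args scale p q"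
    if "(\<alpha>, w) \<in> args scale p q" "j \<in> {1..q}" for \<alpha> w j v
    using that by (auto simp: args_def PiE_iff extensional_def)
  have t1: "tensor scale p q u \<phi> (\<alpha>(i := a), w) =
        a (u i) * ((\<Prod>k\<in>{1..p}-{i}. \<alpha> k (u k)) * (\<Prod>j=1..q. \<phi> j (w j)))"
    if "(\<alpha>, w) \<in> args scale p q" "i \<in> {1..p}" "a \<in> dual scale" for \<alpha> w i a
    using upd1[OF that] prod_upd_slot[OF that(2), of "\<lambda>k f. f (u k)" \<alpha> a]
    by (simp add: tensor_def mult.assoc)
  have t2: "tensor scale p q u \<phi> (\<alpha>, w(j := v)) =
        \<phi> j v * ((\<Prod>i=1..p. \<alpha> i (u i)) * (\<Prod>k\<in>{1..q}-{j}. \<phi> k (w k)))"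
    if "(\<alpha>, w) \<in> args scale p q" "j \<in> {1..q}" for \<alpha> w j v
    using upd2[OF that] prod_upd_slot[OF that(2), of \<phi> w v]
    by (simp add: tensor_def mult_ac)
  have "multilinear_map scale (*) p q (tensor scale p q u \<phi>)"
    unfolding multilinear_map_def
  proof (intro allI impI conjI ballI)
    fix \<alpha> w j
    assume "(\<alpha>, w) \<in> args scale p q" "j \<in> {1..q}"
    then show "Vector_Spaces.linear scale (*) (\<lambda>x. tensor scale p q u \<phi> (\<alpha>, w(j := x)))"
      using vs[of j] by (simp add: t2 Vector_Spaces.linear_iff algebra_simps)
  qed (simp_all add: t1 dual_add algebra_simps)
  then show ?thesis
    by (auto simp: multilinear_forms_def tensor_def)
qed

lemma basis_tensor_args:
  fixes scale :: "complex \<Rightarrow> 'v::ab_group_add \<Rightarrow> 'v"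
  assumes "finite_dimensional_vector_space scale B" and "f \<in> {1..p} \<rightarrow>\<^sub>E B"
  shows "(\<lambda>j\<in>{1..q}. \<lambda>v. module.representation scale B v (g j), f) \<in> args scale q p"
proof -
  interpret finite_dimensional_vector_space scale B by fact
  show ?thesis
    using assms(2) coordinate_linear by (auto simp: args_def dual_def)
qed

theorem tensor_space_eq_multilinear_forms:
  fixes scale :: "complex \<Rightarrow> 'v::ab_group_add \<Rightarrow> 'v"
  assumes fd: "finite_dimensional_vector_space scale B"
  shows "tensor_space scale p q = multilinear_forms scale p q"
proof
  interpret V: finite_dimensional_vector_space scale B by (rule fd)
  show "tensor_space scale p q \<subseteq> multilinear_forms scale p q"
    unfolding tensor_space_def
    by (rule form.span_minimal)
       (auto intro!: tensor_in_multilinear_forms multilinear_forms_subspace V.vector_space_axioms)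
  show "multilinear_forms scale p q \<subseteq> tensor_space scale p q"
  proof
    fix F assume F: "F \<in> multilinear_forms scale p q"
    define e where "e = (\<lambda>b v. V.representation B v b)"
    have vs: "vector_space ((*) :: complex \<Rightarrow> complex \<Rightarrow> complex)"
      by unfold_locales (auto simp: algebra_simps)
    have "F = (\<Sum>f\<in>{1..p} \<rightarrow>\<^sub>E B. \<Sum>g\<in>{1..q} \<rightarrow>\<^sub>E B.
            form_scale (F (\<lambda>i\<in>{1..p}. e (f i), g)) (tensor scale p q f (\<lambda>j\<in>{1..q}. e (g j))))"
      (is "_ = ?R")
    proof (rule ext, clarify)
      fix \<alpha> w
      have R: "?R (\<alpha>, w) = (\<Sum>f\<in>{1..p} \<rightarrow>\<^sub>E B. \<Sum>g\<in>{1..q} \<rightarrow>\<^sub>E B.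
          F (\<lambda>i\<in>{1..p}. e (f i), g) * tensor scale p q f (\<lambda>j\<in>{1..q}. e (g j)) (\<alpha>, w))"
        by (simp add: form_scale_def sum_fun_apply)
      show "F (\<alpha>, w) = ?R (\<alpha>, w)"
      proof (cases "(\<alpha>, w) \<in> args scale p q")
        case True
        have "multilinear_map scale (*) p q F" using F by (simp add: multilinear_forms_def)
        from multilinear_map_expansion[OF fd vs this True] True
        show ?thesis unfolding R by (simp add: tensor_def e_def mult_ac)
      next
        case False
        then show ?thesis using F unfolding R by (simp add: multilinear_forms_def tensor_def)
      qed
    qed
    also have "\<dots> \<in> tensor_space scale p q"
      unfolding tensor_space_def
      by (intro form.span_sum form.span_scale form.span_base)
         (use basis_tensor_args[OF fd] in \<open>unfold e_def, blast\<close>)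
    finally show "F \<in> tensor_space scale p q" .
  qed
qed

text \<open>
  Every map multilinear in \<open>p\<close> vectors and \<open>q\<close> covectors factors through \<open>tensor\<close> by a linear
  map, which is unique on the tensor space.
\<close>

theorem tensor_space_universal:
  fixes scale :: "complex \<Rightarrow> 'v::ab_group_add \<Rightarrow> 'v" and s :: "complex \<Rightarrow> 'w::ab_group_add \<Rightarrow> 'w"
  assumes fd: "finite_dimensional_vector_space scale B"
    and s: "vector_space s"
    and m: "multilinear_map scale s q p m"
  shows "\<exists>L. Vector_Spaces.linear form_scale s L \<and>
             (\<forall>\<phi> u. (\<phi>, u) \<in> args scale q p \<longrightarrow> L (tensor scale p q u \<phi>) = m (\<phi>, u))"
proof -
  interpret V: finite_dimensional_vector_space scale B by (rule fd)
  interpret s: vector_space s by (rule s)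
  define e where "e = (\<lambda>b v. V.representation B v b)"
  have e_dual: "e b \<in> dual scale" for b
    unfolding dual_def e_def using V.coordinate_linear by simp
  define L where "L T = (\<Sum>f\<in>{1..q} \<rightarrow>\<^sub>E B. \<Sum>g\<in>{1..p} \<rightarrow>\<^sub>E B.
      s (T (\<lambda>i\<in>{1..p}. e (g i), f)) (m (\<lambda>j\<in>{1..q}. e (f j), g)))" for T
  have "Vector_Spaces.linear form_scale s L"
    unfolding Vector_Spaces.linear_iff
    by (auto simp: vector_space_form_scale s L_def form_scale_def s.scale_left_distrib
          sum.distrib s.scale_sum_right)
  moreover have "L (tensor scale p q u \<phi>) = m (\<phi>, u)" if x: "(\<phi>, u) \<in> args scale q p" for \<phi> u
  proof -
    have w_args: "(\<lambda>i\<in>{1..p}. e (g i), f) \<in> args scale p q" if "f \<in> {1..q} \<rightarrow>\<^sub>E B" for f g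
      using that e_dual by (auto simp: args_def)
    have "L (tensor scale p q u \<phi>) = (\<Sum>f\<in>{1..q} \<rightarrow>\<^sub>E B. \<Sum>g\<in>{1..p} \<rightarrow>\<^sub>E B.
        s ((\<Prod>j=1..q. \<phi> j (f j)) * (\<Prod>i=1..p. e (g i) (u i))) (m (\<lambda>j\<in>{1..q}. e (f j), g)))"
      unfolding L_def using w_args
      by (intro sum.cong refl) (simp add: tensor_def mult.commute)
    then show ?thesis
      by (simp only: e_def multilinear_map_expansion[OF fd s m x, symmetric])
  qed
  ultimately show ?thesis by blast
qed

theorem tensor_space_universal_unique:
  fixes scale :: "complex \<Rightarrow> 'v::ab_group_add \<Rightarrow> 'v" and s :: "complex \<Rightarrow> 'w::ab_group_add \<Rightarrow> 'w"
  assumes L: "Vector_Spaces.linear form_scale s L" "Vector_Spaces.linear form_scale s L'"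
    and eq: "\<And>\<phi> u. (\<phi>, u) \<in> args scale q p \<Longrightarrow>
               L (tensor scale p q u \<phi>) = L' (tensor scale p q u \<phi>)"
    and T: "T \<in> tensor_space scale p q"
  shows "L T = L' T"
proof -
  interpret P: vector_space_pair "form_scale :: complex \<Rightarrow> ('v args \<Rightarrow> complex) \<Rightarrow> _" s
    using L(1) by (simp add: vector_space_pair_def Vector_Spaces.linear_def)
  show ?thesis
    using T unfolding tensor_space_def by (rule P.linear_eq_on_span[OF L, rotated]) (use eq in auto)
qed

end

theory Submission
  imports Defs "HOL-Combinatorics.Permutations" "HOL-Library.Fun_Lexorder"
begin

text \<open>
  A 1-regular diagram is a permutation \<open>\<sigma>\<close>, read as the form
  \<open>D\<^sub>\<sigma>(\<alpha>, w) = \<Prod>\<^sub>i \<alpha> i (w (\<sigma> i))\<close>, and a strict nesting is a decreasing subsequence of \<open>\<sigma>\<close>.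
  So the claim is that the \<open>D\<^sub>\<sigma>\<close> for which \<open>\<sigma>\<close> has no decreasing subsequence of length \<open>k + 1\<close>
  form a basis of the invariants; call these \<open>\<sigma>\<close> bounded.  A multilinear form is determined by
  its values on basis covectors and basis vectors, that is, by a matrix indexed by pairs of
  words \<open>I, J : {1..p} \<rightarrow> Basis\<close>; the matrix of \<open>D\<^sub>\<sigma>\<close> is the permutation matrix \<open>[I = J \<circ> \<sigma>]\<close>.

  \<^emph>\<open>The \<open>D\<^sub>\<sigma>\<close> span the invariants\<close> (\<open>first_fundamental_theorem\<close>).  Invariance of \<open>F\<close> says that
  its matrix commutes with all tensor powers \<open>g \<otimes> \<cdots> \<otimes> g\<close> of invertible \<open>g\<close>.  An inclusion-exclusion
  formula of Ryser type (\<open>shifted_ryser\<close>) writes every \<open>S\<^sub>p\<close>-symmetric matrix as a linear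
  combination of such tensor powers, so the matrix of \<open>F\<close> commutes with the whole commutant of the
  permutation action of \<open>S\<^sub>p\<close> on words.  The double commutant theorem, proved by averaging a
  projection (\<open>double_commutant_permutation_group\<close>), puts it in the span of the permutation
  matrices.

  \<^emph>\<open>The bounded ones suffice\<close> (\<open>perm_form_straightening\<close>).  Antisymmetrising a diagram over \<open>k + 1\<close>
  indices gives zero, because a word in \<open>k\<close> letters repeats a letter on \<open>k + 1\<close> positions
  (\<open>antisymmetriser_vanishes\<close>).  If \<open>\<sigma>\<close> decreases on these indices, every other term of the
  antisymmetriser is lexicographically smaller than \<open>\<sigma>\<close>, so \<open>D\<^sub>\<sigma>\<close> can be eliminated.

  \<^emph>\<open>The bounded ones are independent\<close> (\<open>separating_point\<close>).  Colour \<open>i\<close> by the length of the longest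
  decreasing subsequence of \<open>\<sigma>\<close> that ends in \<open>i\<close>.  At most \<open>k\<close> colours occur and \<open>\<sigma>\<close> is increasing
  on each colour class.  Evaluate at \<open>\<alpha> i = coord (e (c i))\<close> and \<open>w (\<sigma> i) = e (c i)\<close>, where \<open>c\<close> is
  the colouring and \<open>e\<close> enumerates the basis: the value of \<open>D\<^sub>\<tau>\<close> is \<open>1\<close> if \<open>\<tau>\<close> sends every colour
  class to the same set as \<open>\<sigma>\<close> does, and \<open>0\<close> otherwise.  As \<open>\<sigma>\<close> is sorted on each class, it is the
  lexicographically least such \<open>\<tau>\<close>, and the evaluations are triangular.

  For \<open>p \<noteq> q\<close> the scalar \<open>2 \<in> GL(V)\<close> acts by \<open>2 ^ p / 2 ^ q \<noteq> 1\<close>, so that only \<open>0\<close> is invariant.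
\<close>

section \<open>Arc diagrams as permutations\<close>

definition permutation_diagram :: "nat \<Rightarrow> (nat \<Rightarrow> nat) \<Rightarrow> arc multiset" where
  "permutation_diagram p \<sigma> = mset_set ((\<lambda>i. (i, \<sigma> i)) ` {1..p})"

definition bounded_permutations :: "nat \<Rightarrow> nat \<Rightarrow> (nat \<Rightarrow> nat) set" where
  "bounded_permutations k p =
     {\<sigma>. \<sigma> permutes {1..p} \<and> (\<forall>S\<subseteq>{1..p}. strict_antimono_on S \<sigma> \<longrightarrow> card S \<le> k)}"

lemma set_permutation_diagram: "set_mset (permutation_diagram p \<sigma>) = (\<lambda>i. (i, \<sigma> i)) ` {1..p}"
  by (simp add: permutation_diagram_def)

lemma one_regular_permutation_diagram:
  assumes "\<sigma> permutes {1..p}"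
  shows "permutation_diagram p \<sigma> \<in> arc_diagrams p" "one_regular p (permutation_diagram p \<sigma>)"
proof -
  let ?A = "(\<lambda>i. (i, \<sigma> i)) ` {1..p}"
  have in_iff: "\<sigma> i \<in> {1..p} \<longleftrightarrow> i \<in> {1..p}" for i by (rule permutes_in_image[OF assms])
  show "permutation_diagram p \<sigma> \<in> arc_diagrams p"
    using in_iff unfolding arc_diagrams_def mem_Collect_eq set_permutation_diagram by blast
  have size: "size {#a \<in># permutation_diagram p \<sigma>. P a#} = card {a \<in> ?A. P a}" for P
    by (simp add: permutation_diagram_def)
  show "one_regular p (permutation_diagram p \<sigma>)"
    unfolding one_regular_def
  proof (intro conjI ballI)
    fix i assume "i \<in> {1..p}"
    then have "{a \<in> ?A. fst a = i} = {(i, \<sigma> i)}" by auto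
    then show "size {#a \<in># permutation_diagram p \<sigma>. fst a = i#} = 1" unfolding size by simp
  next
    fix j assume j: "j \<in> {1..p}"
    have "{a \<in> ?A. snd a = j} = {(inv \<sigma> j, j)}"
    proof (rule set_eqI)
      fix a :: arc
      have "inv \<sigma> j \<in> {1..p}" using j permutes_in_image[OF permutes_inv[OF assms]] by blast
      moreover have "\<sigma> (inv \<sigma> j) = j" using permutes_inverses(1)[OF assms] .
      moreover have "inv \<sigma> (\<sigma> (fst a)) = fst a" using permutes_inverses(2)[OF assms] .
      ultimately show "a \<in> {a \<in> ?A. snd a = j} \<longleftrightarrow> a \<in> {(inv \<sigma> j, j)}"
        by (cases a) force
    qed
    then show "size {#a \<in># permutation_diagram p \<sigma>. snd a = j#} = 1" unfolding size by simp
  qed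
qed

text \<open>
  Degree one at \<open>i\<^sup>*\<close> makes the partner of \<open>i\<close> unique, with multiplicity one, and degree one at the
  unstarred vertices makes the resulting map injective.
\<close>

lemma one_regular_imp_permutation_diagram:
  assumes D: "D \<in> arc_diagrams p" "one_regular p D"
  shows "\<exists>\<sigma>. \<sigma> permutes {1..p} \<and> D = permutation_diagram p \<sigma>"
proof -
  have sub: "set_mset D \<subseteq> {1..p} \<times> {1..p}" using D(1) by (simp add: arc_diagrams_def)
  have "\<exists>j. {#a \<in># D. fst a = i#} = {#(i, j)#}" if i: "i \<in> {1..p}" for i
  proof -
    obtain a where a: "{#a \<in># D. fst a = i#} = {#a#}"
      using D(2) i by (metis one_regular_def size_1_singleton_mset)
    then have "a \<in># {#a \<in># D. fst a = i#}" by simp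
    then have "fst a = i" by simp
    then show ?thesis using a by (metis prod.collapse)
  qed
  then obtain s where s: "\<And>i. i \<in> {1..p} \<Longrightarrow> {#a \<in># D. fst a = i#} = {#(i, s i)#}"
    by metis
  define \<sigma> where "\<sigma> i = (if i \<in> {1..p} then s i else i)" for i
  have cnt: "count D (i, j) = (if j = s i then 1 else 0)" if "i \<in> {1..p}" for i j
  proof -
    have "count D (i, j) = count {#a \<in># D. fst a = i#} (i, j)" by simp
    then show ?thesis using s[OF that] by simp
  qed
  have mem: "(i, s i) \<in># D" if "i \<in> {1..p}" for i
    using cnt[OF that, of "s i"] by (simp add: count_greater_zero_iff[symmetric] del: count_greater_zero_iff)
  have inj: "i = i'" if i: "i \<in> {1..p}" "i' \<in> {1..p}" "s i = s i'" for i i'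
  proof -
    have "s i \<in> {1..p}" using mem[OF i(1)] sub by auto
    then obtain a where a: "{#b \<in># D. snd b = s i#} = {#a#}"
      using D(2) by (metis one_regular_def size_1_singleton_mset)
    have "(i, s i) \<in># {#b \<in># D. snd b = s i#}" "(i', s i) \<in># {#b \<in># D. snd b = s i#}"
      using mem[OF i(1)] mem[OF i(2)] i(3) by auto
    then show ?thesis unfolding a by auto
  qed
  have "s i \<in> {1..p}" if "i \<in> {1..p}" for i using mem[OF that] sub by auto
  then have "s ` {1..p} \<subseteq> {1..p}" by blast
  moreover have "inj_on s {1..p}" using inj by (rule inj_onI)
  ultimately have "bij_betw s {1..p} {1..p}"
    by (simp add: bij_betw_def endo_inj_surj)
  moreover have "bij_betw \<sigma> {1..p} {1..p} \<longleftrightarrow> bij_betw s {1..p} {1..p}"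
    by (rule bij_betw_cong) (simp add: \<sigma>_def)
  moreover have "{i. \<sigma> i \<noteq> i} \<subseteq> {1..p}" by (auto simp: \<sigma>_def)
  ultimately have "\<sigma> permutes {1..p}" by (simp add: permutes_altdef)
  moreover have "D = permutation_diagram p \<sigma>"
  proof (rule multiset_eqI, clarify)
    fix i j
    show "count D (i, j) = count (permutation_diagram p \<sigma>) (i, j)"
    proof (cases "i \<in> {1..p}")
      case True
      then show ?thesis
        by (auto simp: cnt permutation_diagram_def count_mset_set' \<sigma>_def)
    next
      case False
      then have "(i, j) \<notin># D" using sub by auto
      then show ?thesis using False
        by (auto simp: permutation_diagram_def count_mset_set' not_in_iff)
    qed
  qed
  ultimately show ?thesis by blast
qed

lemma strict_nesting_permutation_diagram:
  "strict_nesting (permutation_diagram p \<sigma>) N \<longleftrightarrow>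
     (\<exists>S\<subseteq>{1..p}. N = (\<lambda>i. (i, \<sigma> i)) ` S \<and> strict_antimono_on S \<sigma>)"
proof
  assume "strict_nesting (permutation_diagram p \<sigma>) N"
  then have N: "N \<subseteq> (\<lambda>i. (i, \<sigma> i)) ` {1..p}"
    and nest: "\<And>a b. a \<in> N \<Longrightarrow> b \<in> N \<Longrightarrow> a \<noteq> b \<Longrightarrow> strictly_nested a b"
    by (auto simp: strict_nesting_def set_permutation_diagram)
  from N obtain S where S: "S \<subseteq> {1..p}" "N = (\<lambda>i. (i, \<sigma> i)) ` S" by (auto simp: subset_image_iff)
  have "\<sigma> j < \<sigma> i" if "i \<in> S" "j \<in> S" "i < j" for i j
    using nest[of "(i, \<sigma> i)" "(j, \<sigma> j)"] that S(2) by (auto simp: strictly_nested_def)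
  then show "\<exists>S\<subseteq>{1..p}. N = (\<lambda>i. (i, \<sigma> i)) ` S \<and> strict_antimono_on S \<sigma>"
    using S by (intro exI[of _ S]) (auto simp: monotone_on_def)
next
  assume "\<exists>S\<subseteq>{1..p}. N = (\<lambda>i. (i, \<sigma> i)) ` S \<and> strict_antimono_on S \<sigma>"
  then obtain S where "S \<subseteq> {1..p}" "N = (\<lambda>i. (i, \<sigma> i)) ` S" "strict_antimono_on S \<sigma>" by blast
  moreover have "strictly_nested (i, \<sigma> i) (j, \<sigma> j)" if "i \<in> S" "j \<in> S" "i \<noteq> j" for i j
    using that \<open>strict_antimono_on S \<sigma>\<close>
    by (cases i j rule: linorder_cases) (auto simp: strictly_nested_def monotone_on_def)
  ultimately show "strict_nesting (permutation_diagram p \<sigma>) N"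
    by (auto simp: strict_nesting_def set_permutation_diagram)
qed

lemma nesting_bounded_diagrams_eq:
  "nesting_bounded_diagrams k p = permutation_diagram p ` bounded_permutations k p"
proof -
  have card: "card ((\<lambda>i. (i, \<sigma> i)) ` S) = card S" for S :: "nat set" and \<sigma> :: "nat \<Rightarrow> nat"
    by (intro card_image inj_onI) simp
  have "(\<forall>N. strict_nesting (permutation_diagram p \<sigma>) N \<longrightarrow> card N \<le> k) \<longleftrightarrow>
        (\<forall>S\<subseteq>{1..p}. strict_antimono_on S \<sigma> \<longrightarrow> card S \<le> k)" for \<sigma>
  proof (intro iffI allI impI)
    fix S assume "\<forall>N. strict_nesting (permutation_diagram p \<sigma>) N \<longrightarrow> card N \<le> k"
      and "S \<subseteq> {1..p}" "strict_antimono_on S \<sigma>"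
    then have "card ((\<lambda>i. (i, \<sigma> i)) ` S) \<le> k"
      unfolding strict_nesting_permutation_diagram by blast
    then show "card S \<le> k" by (simp only: card)
  next
    fix N assume *: "\<forall>S\<subseteq>{1..p}. strict_antimono_on S \<sigma> \<longrightarrow> card S \<le> k"
      and "strict_nesting (permutation_diagram p \<sigma>) N"
    then obtain S where "S \<subseteq> {1..p}" "strict_antimono_on S \<sigma>" "N = (\<lambda>i. (i, \<sigma> i)) ` S"
      unfolding strict_nesting_permutation_diagram by blast
    then show "card N \<le> k" using * by (simp only: card)
  qed
  note bounded = this
  show ?thesis
  proof
    show "nesting_bounded_diagrams k p \<subseteq> permutation_diagram p ` bounded_permutations k p"
    proof
      fix D assume D: "D \<in> nesting_bounded_diagrams k p"
      then obtain \<sigma> where "\<sigma> permutes {1..p}" "D = permutation_diagram p \<sigma>"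
        unfolding nesting_bounded_diagrams_def using one_regular_imp_permutation_diagram by blast
      then show "D \<in> permutation_diagram p ` bounded_permutations k p"
        using D bounded[of \<sigma>] unfolding nesting_bounded_diagrams_def bounded_permutations_def by blast
    qed
    show "permutation_diagram p ` bounded_permutations k p \<subseteq> nesting_bounded_diagrams k p"
      using one_regular_permutation_diagram bounded
      unfolding nesting_bounded_diagrams_def bounded_permutations_def by blast
  qed
qed

section \<open>Decreasing subsequences and colourings\<close>

text \<open>
  Mirsky's argument for permutations: colour \<open>i\<close> by the length of the longest
  decreasing subsequence that ends in \<open>i\<close>.  If \<open>i < j\<close> but \<open>\<sigma> i > \<sigma> j\<close>, a decreasing subsequence
  ending in \<open>i\<close> can be prolonged by \<open>j\<close>, so that \<open>j\<close> gets a larger colour.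
\<close>

lemma bounded_permutation_colouring:
  assumes "\<sigma> \<in> bounded_permutations k p"
  shows "\<exists>c. c \<in> {1..p} \<rightarrow> {1..k} \<and>
             (\<forall>i\<in>{1..p}. \<forall>j\<in>{1..p}. c i = c j \<longrightarrow> i < j \<longrightarrow> \<sigma> i < \<sigma> j)"
proof -
  define D where "D i = {S. S \<subseteq> {1..i} \<and> i \<in> S \<and> strict_antimono_on S \<sigma>}" for i
  define c where "c i = Max (card ` D i)" for i
  have fin: "finite (D i)" for i
    by (rule finite_subset[of _ "Pow {1..i}"]) (auto simp: D_def)
  have sing: "{i} \<in> D i" if "i \<in> {1..p}" for i
    using that by (auto simp: D_def monotone_on_def)
  have "c i \<in> {1..k}" if i: "i \<in> {1..p}" for i
  proof -
    have "1 \<le> c i"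
      unfolding c_def using imageI[OF sing[OF i], of card] fin by (intro Max_ge) simp_all
    moreover have "card S \<le> k" if "S \<in> D i" for S
    proof -
      have "S \<subseteq> {1..p}" "strict_antimono_on S \<sigma>" using that i by (auto simp: D_def)
      then show ?thesis using assms by (simp add: bounded_permutations_def)
    qed
    then have "c i \<le> k"
      unfolding c_def using sing[OF i] fin by (subst Max_le_iff) auto
    ultimately show ?thesis by simp
  qed
  moreover have "\<sigma> i < \<sigma> j" if ij: "i \<in> {1..p}" "j \<in> {1..p}" "c i = c j" "i < j" for i j
  proof (rule ccontr)
    assume "\<not> \<sigma> i < \<sigma> j"
    moreover have "\<sigma> i \<noteq> \<sigma> j"
      using assms ij(4) permutes_inj[of \<sigma> "{1..p}"] by (auto simp: bounded_permutations_def inj_eq)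
    ultimately have less: "\<sigma> j < \<sigma> i" by simp
    have "c i \<in> card ` D i" unfolding c_def using sing[OF ij(1)] fin by (intro Max_in) auto
    then obtain S where S: "S \<subseteq> {1..i}" "i \<in> S" "strict_antimono_on S \<sigma>" "card S = c i"
      by (auto simp: D_def)
    have le: "\<sigma> i \<le> \<sigma> l" if "l \<in> S" for l
      using S that by (cases "l = i") (auto simp: monotone_on_def subset_iff order.order_iff_strict)
    have "insert j S \<in> D j"
    proof -
      have "\<sigma> b < \<sigma> a" if "a \<in> insert j S" "b \<in> insert j S" "a < b" for a b
      proof (cases "b = j")
        case True
        then show ?thesis using that le[of a] less by auto
      next
        case False
        then have "a \<in> S" "b \<in> S" using that S(1) ij(4) by auto
        then show ?thesis using S(3) that(3) by (auto simp: monotone_on_def)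
      qed
      then show ?thesis using S(1) ij by (auto simp: D_def monotone_on_def)
    qed
    then have "card (insert j S) \<le> c j" unfolding c_def using fin by (intro Max_ge) auto
    moreover have "j \<notin> S" "finite S" using S(1) ij(4) by (auto intro: finite_subset)
    ultimately show False using S(4) ij(3) by simp
  qed
  ultimately show ?thesis by (intro exI[of _ c]) blast
qed

text \<open>
  The hypothesis \<open>col\<close> says that \<open>\<tau>\<close> sends each colour class to the same set as \<open>\<sigma>\<close> does.  Since \<open>\<sigma>\<close>
  is sorted on each class, at the first place where \<open>\<tau>\<close> differs it must pick a value that \<open>\<sigma>\<close> uses
  only later in that class, hence a larger one.
\<close>

lemma less_fun_if_same_colours:
  assumes "\<sigma> permutes A" "\<tau> permutes A"
    and incr: "\<And>i j. i \<in> A \<Longrightarrow> j \<in> A \<Longrightarrow> c i = c j \<Longrightarrow> i < j \<Longrightarrow> \<sigma> i < \<sigma> j"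
    and col: "\<And>i. i \<in> A \<Longrightarrow> c (inv \<sigma> (\<tau> i)) = c i" and "\<tau> \<noteq> \<sigma>"
  shows "less_fun \<sigma> (\<tau> :: nat \<Rightarrow> nat)"
proof -
  obtain i where i: "\<tau> i \<noteq> \<sigma> i" and least: "\<And>j. j < i \<Longrightarrow> \<tau> j = \<sigma> j"
    using \<open>\<tau> \<noteq> \<sigma>\<close> exists_least_iff[of "\<lambda>i. \<tau> i \<noteq> \<sigma> i"] by blast
  have iA: "i \<in> A" using i permutes_not_in[OF assms(1)] permutes_not_in[OF assms(2)] by metis
  define j where "j = inv \<sigma> (\<tau> i)"
  have sj: "\<sigma> j = \<tau> i" using permutes_inverses[OF assms(1)] by (simp add: j_def)
  have jA: "j \<in> A"
    using iA sj permutes_in_image[OF assms(1)] permutes_in_image[OF assms(2)] by metis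
  have "j \<noteq> i" using sj i by auto
  moreover have "\<not> j < i"
    using least[of j] sj i permutes_inj[OF assms(2)] by (auto simp: inj_eq)
  ultimately have "\<sigma> i < \<sigma> j" using incr[OF iA jA] col[OF iA] by (simp add: j_def)
  then show ?thesis using least sj by (intro less_funI exI[of _ i]) auto
qed

text \<open>
  The first index that \<open>\<pi>\<close> moves can only move to the right, where \<open>\<sigma>\<close> is smaller.
\<close>

lemma less_fun_rearranged_antimono:
  assumes "\<pi> permutes S" "\<pi> \<noteq> id" "strict_antimono_on S \<sigma>"
  shows "less_fun (\<sigma> \<circ> \<pi>) (\<sigma> :: nat \<Rightarrow> nat)"
proof -
  obtain i where i: "\<pi> i \<noteq> i" and least: "\<And>j. j < i \<Longrightarrow> \<pi> j = j"
    using \<open>\<pi> \<noteq> id\<close> exists_least_iff[of "\<lambda>i. \<pi> i \<noteq> i"] by (auto simp: fun_eq_iff)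
  have iS: "i \<in> S" using i permutes_not_in[OF assms(1)] by metis
  then have "\<pi> i \<in> S" using permutes_in_image[OF assms(1)] by simp
  moreover have "i < \<pi> i"
    using i least[of "\<pi> i"] permutes_inj[OF assms(1)] by (metis injD linorder_neqE_nat)
  ultimately have "\<sigma> (\<pi> i) < \<sigma> i" using assms(3) iS by (auto simp: monotone_on_def)
  then show ?thesis using least by (intro less_funI exI[of _ i]) auto
qed

section \<open>A shifted Ryser formula\<close>

lemma alternating_sum_supersets:
  assumes "finite A" "U \<subseteq> A"
  shows "(\<Sum>S | S \<subseteq> A \<and> U \<subseteq> S. (- 1) ^ (card A - card S)) = (if U = A then 1 else 0 :: 'a::comm_ring_1)"
proof (cases "U = A")
  case True
  then have "{S. S \<subseteq> A \<and> U \<subseteq> S} = {A}" by auto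
  then show ?thesis using True by simp
next
  case False
  have fin: "finite {S. S \<subseteq> A \<and> U \<subseteq> S}" using assms(1) by simp
  have "(\<Sum>S | S \<subseteq> A \<and> U \<subseteq> S. (- 1) ^ (card A - card S))
      = (\<Sum>S | S \<subseteq> A \<and> U \<subseteq> S. (- 1) ^ card A * (- 1) ^ card S :: 'a)"
  proof (rule sum.cong[OF refl])
    fix S assume "S \<in> {S. S \<subseteq> A \<and> U \<subseteq> S}"
    then have "card S \<le> card A" using assms(1) by (simp add: card_mono)
    then show "(- 1) ^ (card A - card S) = (- 1) ^ card A * (- 1 :: 'a) ^ card S"
      by (cases "even (card S)"; cases "even (card A)") (auto simp: minus_one_power_iff)
  qed
  also have "\<dots> = (- 1) ^ card A * (\<Sum>S | S \<subseteq> A \<and> U \<subseteq> S. (- 1) ^ card S)"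
    by (simp add: sum_distrib_left)
  also have "(\<Sum>S | S \<subseteq> A \<and> U \<subseteq> S. (- 1) ^ card S) = (0 :: 'a)"
    using card_subsupersets_even_odd[OF assms(1), of U] assms(2) False fin
    by (intro sum_alternating_cancels) (auto simp: conj_assoc psubset_eq)
  finally show ?thesis using False by simp
qed

lemma sum_over_restricted_permutations:
  "(\<Sum>f | f \<in> A \<rightarrow>\<^sub>E A \<and> f ` A = A. h f) = (\<Sum>\<sigma> | \<sigma> permutes A. h (restrict \<sigma> A))" if "finite A"
proof (rule sum.reindex_bij_witness[where j = "\<lambda>f x. if x \<in> A then f x else x" and i = "\<lambda>\<sigma>. restrict \<sigma> A"])
  fix f assume f: "f \<in> {f. f \<in> A \<rightarrow>\<^sub>E A \<and> f ` A = A}"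
  then show "restrict (\<lambda>x. if x \<in> A then f x else x) A = f"
    by (auto simp: PiE_iff extensional_def fun_eq_iff)
  then show "h (restrict (\<lambda>x. if x \<in> A then f x else x) A) = h f" by simp
  have "inj_on f A" using f that by (auto intro: eq_card_imp_inj_on)
  then have "bij_betw f A A" using f by (auto simp: bij_betw_def)
  then have "bij_betw (\<lambda>x. if x \<in> A then f x else x) A A" 
    by (subst bij_betw_cong[where g = f]) auto
  then show "(\<lambda>x. if x \<in> A then f x else x) \<in> {\<sigma>. \<sigma> permutes A}"
    by (auto simp: permutes_altdef)
next
  fix \<sigma> assume s: "\<sigma> \<in> {\<sigma>. \<sigma> permutes A}"
  then show "(\<lambda>x. if x \<in> A then restrict \<sigma> A x else x) = \<sigma>"
    by (auto simp: permutes_not_in)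
  show "restrict \<sigma> A \<in> {f. f \<in> A \<rightarrow>\<^sub>E A \<and> f ` A = A}"
    using s permutes_image[of \<sigma> A] by (auto simp: permutes_in_image)
qed

text \<open>
  Ryser's formula for the permanent of \<open>y\<close>, with a shift \<open>z\<close> of the row sums that does not change
  the value.  The left-hand side is a \<open>p\<close>-th finite difference: expanding the product, a term
  contributes only if every column \<open>s \<in> {1..p}\<close> is chosen, which for \<open>p\<close> factors leaves no room for
  a factor \<open>z i\<close>.  The shift is what later makes the matrices involved invertible.
\<close>

lemma shifted_ryser:
  fixes y :: "nat \<Rightarrow> nat \<Rightarrow> 'a::comm_ring_1" and z :: "nat \<Rightarrow> 'a"
  shows "(\<Sum>S | S \<subseteq> {1..p}. (- 1) ^ (p - card S) * (\<Prod>i=1..p. z i + (\<Sum>s\<in>S. y i s)))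
       = (\<Sum>\<sigma> | \<sigma> permutes {1..p}. \<Prod>i=1..p. y i (\<sigma> i))"
proof -
  let ?A = "{1..p}"
  \<comment> \<open>The shift becomes column \<open>0\<close> of an extended array.\<close>
  define Y where "Y i s = (if s = 0 then z i else y i s)" for i s
  let ?F = "?A \<rightarrow>\<^sub>E {0..p}"
  have finF: "finite ?F" by (intro finite_PiE) auto
  have prod: "(\<Prod>i=1..p. z i + (\<Sum>s\<in>S. y i s)) = (\<Sum>f\<in>?F. (if f ` ?A - {0} \<subseteq> S then \<Prod>i=1..p. Y i (f i) else 0))"
    if S: "S \<subseteq> ?A" for S
  proof -
    have finS: "finite S" and S0: "0 \<notin> S" using S finite_subset[OF S] by auto
    have "z i + (\<Sum>s\<in>S. y i s) = (\<Sum>s\<in>insert 0 S. Y i s)" for i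
    proof -
      have "(\<Sum>s\<in>S. y i s) = (\<Sum>s\<in>S. Y i s)" using S0 by (intro sum.cong) (auto simp: Y_def)
      then show ?thesis using finS S0 by (simp add: Y_def)
    qed
    then have "(\<Prod>i=1..p. z i + (\<Sum>s\<in>S. y i s)) = (\<Prod>i=1..p. \<Sum>s\<in>insert 0 S. Y i s)" by simp
    also have "\<dots> = (\<Sum>f\<in>?A \<rightarrow>\<^sub>E insert 0 S. \<Prod>i=1..p. Y i (f i))"
      using finS by (intro prod_sum_PiE) auto
    also have "\<dots> = (\<Sum>f\<in>?F. (if f ` ?A - {0} \<subseteq> S then \<Prod>i=1..p. Y i (f i) else 0))"
    proof (rule sum.mono_neutral_cong_left[OF finF])
      show "?A \<rightarrow>\<^sub>E insert 0 S \<subseteq> ?F" using S by (intro PiE_mono) auto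
      show "\<forall>f\<in>?F - (?A \<rightarrow>\<^sub>E insert 0 S). (if f ` ?A - {0} \<subseteq> S then \<Prod>i=1..p. Y i (f i) else 0) = 0"
        by (auto simp: PiE_iff)
      show "(\<Prod>i=1..p. Y i (f i)) = (if f ` ?A - {0} \<subseteq> S then \<Prod>i=1..p. Y i (f i) else 0)"
        if "f \<in> ?A \<rightarrow>\<^sub>E insert 0 S" for f
        using that by (auto simp: PiE_iff)
    qed
    finally show ?thesis .
  qed
  have "(\<Sum>S | S \<subseteq> ?A. (- 1) ^ (p - card S) * (\<Prod>i=1..p. z i + (\<Sum>s\<in>S. y i s)))
      = (\<Sum>S | S \<subseteq> ?A. \<Sum>f\<in>?F. (if f ` ?A - {0} \<subseteq> S then (- 1) ^ (p - card S) * (\<Prod>i=1..p. Y i (f i)) else 0))"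
    using prod by (intro sum.cong refl) (auto simp: sum_distrib_left intro!: sum.cong)
  also have "\<dots> = (\<Sum>f\<in>?F. \<Sum>S | S \<subseteq> ?A. (if f ` ?A - {0} \<subseteq> S then (- 1) ^ (p - card S) * (\<Prod>i=1..p. Y i (f i)) else 0))"
    by (rule sum.swap)
  also have "\<dots> = (\<Sum>f\<in>?F. if f ` ?A - {0} = ?A then (\<Prod>i=1..p. Y i (f i)) else 0)"
  proof (rule sum.cong[OF refl])
    fix f assume "f \<in> ?F"
    then have U: "f ` ?A - {0} \<subseteq> ?A" by (fastforce simp: PiE_iff)
    have "(\<Sum>S | S \<subseteq> ?A. (if f ` ?A - {0} \<subseteq> S then (- 1) ^ (p - card S) * (\<Prod>i=1..p. Y i (f i)) else 0))
        = (\<Sum>S | S \<subseteq> ?A \<and> f ` ?A - {0} \<subseteq> S. (- 1) ^ (card ?A - card S)) * (\<Prod>i=1..p. Y i (f i))"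
      by (simp add: sum.If_cases sum_distrib_right Int_def)
    then show "(\<Sum>S | S \<subseteq> ?A. (if f ` ?A - {0} \<subseteq> S then (- 1) ^ (p - card S) * (\<Prod>i=1..p. Y i (f i)) else 0))
        = (if f ` ?A - {0} = ?A then (\<Prod>i=1..p. Y i (f i)) else 0)"
      using alternating_sum_supersets[OF _ U, where 'a = 'a] by simp
  qed
  also have "\<dots> = (\<Sum>f | f \<in> ?F \<and> f ` ?A - {0} = ?A. \<Prod>i=1..p. Y i (f i))"
    using finF by (simp add: sum.If_cases Int_def)
  also have "{f. f \<in> ?F \<and> f ` ?A - {0} = ?A} = {f. f \<in> ?A \<rightarrow>\<^sub>E ?A \<and> f ` ?A = ?A}"
  proof (intro Collect_cong iffI)
    fix f assume f: "f \<in> ?F \<and> f ` ?A - {0} = ?A"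
    have "card (f ` ?A) \<le> card ?A" by (rule card_image_le) simp
    then have "f ` ?A = ?A"
      using f card_seteq[of "f ` ?A" ?A] by blast
    then show "f \<in> ?A \<rightarrow>\<^sub>E ?A \<and> f ` ?A = ?A" using f by (auto simp: PiE_iff)
  qed (auto simp: PiE_iff)
  also have "(\<Sum>f | f \<in> ?A \<rightarrow>\<^sub>E ?A \<and> f ` ?A = ?A. \<Prod>i=1..p. Y i (f i))
      = (\<Sum>\<sigma> | \<sigma> permutes ?A. \<Prod>i=1..p. Y i (restrict \<sigma> ?A i))"
    by (rule sum_over_restricted_permutations) simp
  also have "\<dots> = (\<Sum>\<sigma> | \<sigma> permutes ?A. \<Prod>i=1..p. y i (\<sigma> i))"
  proof (intro sum.cong prod.cong refl)
    fix \<sigma> i assume "\<sigma> \<in> {\<sigma>. \<sigma> permutes ?A}" "i \<in> ?A"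
    then have "\<sigma> i \<in> ?A" using permutes_in_image[of \<sigma> ?A i] by blast
    then show "Y i (restrict \<sigma> ?A i) = y i (\<sigma> i)" using \<open>i \<in> ?A\<close> by (simp add: Y_def)
  qed
  finally show ?thesis .
qed

section \<open>The double commutant of a permutation group\<close>

definition permutation_matrix :: "'x set \<Rightarrow> ('x \<Rightarrow> 'x) \<Rightarrow> 'x \<times> 'x \<Rightarrow> complex" where
  "permutation_matrix X g = (\<lambda>(x, y). if x \<in> X \<and> y \<in> X \<and> x = g y then 1 else 0)"

text \<open>
  Let \<open>A\<close> be the span of the permutation matrices of \<open>G\<close>.  Averaging any projection onto \<open>A\<close> gives
  a projection \<open>P\<close> onto \<open>A\<close> that commutes with left multiplication by \<open>G\<close>.  Column \<open>y\<close> of \<open>P N\<close>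
  depends linearly on column \<open>z\<close> of \<open>N\<close> by way of a matrix \<open>T y z\<close>, which is \<open>G\<close>-symmetric because
  \<open>P\<close> is equivariant.  So \<open>M\<close> commutes with every \<open>T y z\<close>, which means \<open>P (M N) = M (P N)\<close>.  For the
  identity matrix \<open>N\<close>, which lies in \<open>A\<close>, this reads \<open>P M = M\<close>, and hence \<open>M \<in> A\<close>.
\<close>

lemma double_commutant_permutation_group:
  fixes G :: "('x \<Rightarrow> 'x) set" and M :: "'x \<times> 'x \<Rightarrow> complex"
  assumes "finite X" and "finite G" and "id \<in> G"
    and bij: "\<And>g. g \<in> G \<Longrightarrow> bij g" and inv: "\<And>g. g \<in> G \<Longrightarrow> inv g \<in> G"
    and comp: "\<And>g h. g \<in> G \<Longrightarrow> h \<in> G \<Longrightarrow> g \<circ> h \<in> G"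
    and stable: "\<And>g x. g \<in> G \<Longrightarrow> g x \<in> X \<longleftrightarrow> x \<in> X"
    and supp: "\<And>x y. x \<notin> X \<or> y \<notin> X \<Longrightarrow> M (x, y) = 0"
    and comm: "\<And>T x y. (\<And>g x y. g \<in> G \<Longrightarrow> T (g x, g y) = T (x, y)) \<Longrightarrow> x \<in> X \<Longrightarrow> y \<in> X \<Longrightarrow>
                 (\<Sum>z\<in>X. M (x, z) * T (z, y)) = (\<Sum>z\<in>X. T (x, z) * M (z, y))"
  shows "M \<in> form.span (permutation_matrix X ` G)"
proof -
  let ?A = "form.span (permutation_matrix X ` G)"
  interpret vp: vector_space_pair "form_scale :: complex \<Rightarrow> ('x \<times> 'x \<Rightarrow> complex) \<Rightarrow> _"
      "form_scale :: complex \<Rightarrow> ('x \<times> 'x \<Rightarrow> complex) \<Rightarrow> _"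
    by unfold_locales
  obtain \<pi> where pi_in: "\<And>N. \<pi> N \<in> ?A" and pi_lin: "Vector_Spaces.linear form_scale form_scale \<pi>"
    and pi_id: "\<And>N. N \<in> ?A \<Longrightarrow> \<pi> N = N"
    using vp.linear_exists_left_inverse_on[of "\<lambda>x. x" ?A] form.linear_ident form.subspace_span
    by (auto simp: image_subset_iff)
  interpret pi: Vector_Spaces.linear form_scale form_scale \<pi> by (rule pi_lin)
  \<comment> \<open>Left multiplication by the permutation matrix of \<open>g\<close>.\<close>
  define act where "act g N = (\<lambda>(x, y). N (inv g x, y))" for g :: "'x \<Rightarrow> 'x" and N :: "'x \<times> 'x \<Rightarrow> complex"
  have act_lin: "Vector_Spaces.linear form_scale form_scale (act g)" for g
    unfolding Vector_Spaces.linear_iff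
    by (auto simp: vector_space_form_scale act_def form_scale_def fun_eq_iff)
  have act_pm: "act g (permutation_matrix X h) = permutation_matrix X (g \<circ> h)" if "g \<in> G" for g h
  proof -
    have "inv g x = h y \<longleftrightarrow> x = g (h y)" for x y
      using bij[OF that] by (metis bij_inv_eq_iff)
    then show ?thesis
      using stable[OF inv[OF that]] by (auto simp: act_def permutation_matrix_def fun_eq_iff)
  qed
  have act_A: "act g N \<in> ?A" if "g \<in> G" "N \<in> ?A" for g N
  proof -
    interpret a: Vector_Spaces.linear form_scale form_scale "act g" by (rule act_lin)
    have "act g ` permutation_matrix X ` G \<subseteq> permutation_matrix X ` G"
      using act_pm comp that(1) by auto
    then have "form.span (act g ` permutation_matrix X ` G) \<subseteq> ?A" by (rule form.span_mono)
    then show ?thesis using that(2) by (auto simp: a.span_image)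
  qed
  have act_act: "act g (act h N) = act (g \<circ> h) N" if "g \<in> G" "h \<in> G" for g h N
    using bij[OF that(1)] bij[OF that(2)] by (simp add: act_def o_inv_distrib)
  have act_inv: "act g (act (inv g) N) = N" "act (inv g) (act g N) = N" if "g \<in> G" for g N
    using bij[OF that] by (auto simp: act_def inv_inv_eq fun_eq_iff bij_is_inj surj_f_inv_f bij_is_surj)
  define P where "P N = form_scale (1 / of_nat (card G)) (\<Sum>g\<in>G. act (inv g) (\<pi> (act g N)))" for N
  have card0: "card G \<noteq> 0" using assms(2,3) by auto
  have P_lin: "Vector_Spaces.linear form_scale form_scale P"
  proof -
    have c: "act g (N + N') = act g N + act g N'" "act g (form_scale c N) = form_scale c (act g N)" for g N N' c
      using act_lin[of g] by (auto simp: Vector_Spaces.linear_iff)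
    show ?thesis
      unfolding Vector_Spaces.linear_iff P_def
      by (auto simp: vector_space_form_scale c pi.add pi.scale sum.distrib form.scale_right_distrib
          form.scale_left_commute simp flip: form.scale_sum_right)
  qed
  interpret P: Vector_Spaces.linear form_scale form_scale P by (rule P_lin)
  have P_in: "P N \<in> ?A" for N
    unfolding P_def by (intro form.span_scale form.span_sum act_A inv pi_in)
  have P_id: "P N = N" if "N \<in> ?A" for N
  proof -
    have "(\<Sum>g\<in>G. act (inv g) (\<pi> (act g N))) = (\<Sum>g\<in>G. N)"
      using that by (intro sum.cong refl) (simp add: pi_id act_A act_inv)
    then show ?thesis using card0 
      by (simp add: P_def form_scale_def fun_eq_iff sum_fun_apply)
  qed
  have P_act: "P (act h N) = act h (P N)" if h: "h \<in> G" for h N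
  proof -
    interpret a: Vector_Spaces.linear form_scale form_scale "act h" by (rule act_lin)
    have hh: "h \<circ> inv h = id" "inv h \<circ> h = id"
      using bij[OF h] by (auto simp: fun_eq_iff bij_is_inj surj_f_inv_f bij_is_surj)
    have "(\<Sum>g\<in>G. act (inv g) (\<pi> (act g (act h N)))) = (\<Sum>g\<in>G. act h (act (inv g) (\<pi> (act g N))))"
    proof (rule sum.reindex_bij_witness[where j = "\<lambda>g. g \<circ> h" and i = "\<lambda>g. g \<circ> inv h"])
      fix g assume g: "g \<in> G"
      show "(g \<circ> h) \<circ> inv h = g" "(g \<circ> inv h) \<circ> h = g" by (simp_all add: o_assoc[symmetric] hh)
      show "g \<circ> h \<in> G" "g \<circ> inv h \<in> G" using g h comp inv by auto
      have "act h (act (inv (g \<circ> h)) N') = act (inv g) N'" for N'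
        using bij[OF g] bij[OF h] g h inv by (simp add: o_inv_distrib act_act[symmetric] act_inv)
      then show "act h (act (inv (g \<circ> h)) (\<pi> (act (g \<circ> h) N))) = act (inv g) (\<pi> (act g (act h N)))"
        using g h by (simp add: act_act)
    qed
    then show ?thesis by (simp add: P_def a.scale a.sum)
  qed
  define E :: "'x \<Rightarrow> 'x \<Rightarrow> 'x \<times> 'x \<Rightarrow> complex"
    where "E u z = (\<lambda>(x, y). if x = u \<and> y = z then 1 else 0)" for u z
  define T where "T y z = (\<lambda>(x, u). P (E u z) (x, y))" for y z
  have T_sym: "T y z (g x, g u) = T y z (x, u)" if g: "g \<in> G" for g x u y z
  proof -
    have "E (g u) z = act g (E u z)"
      using bij[OF g] by (auto simp: E_def act_def fun_eq_iff bij_is_inj surj_f_inv_f bij_is_surj)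
    then have "P (E (g u) z) = act g (P (E u z))" by (simp only: P_act[OF g])
    then show ?thesis
      using bij[OF g] by (simp add: T_def act_def bij_is_inj)
  qed
  have expand: "N = (\<Sum>z\<in>X. \<Sum>u\<in>X. form_scale (N (u, z)) (E u z))"
    if "\<And>x y. x \<notin> X \<or> y \<notin> X \<Longrightarrow> N (x, y) = 0" for N
  proof (rule ext, clarify)
    fix x y
    have "(\<Sum>z\<in>X. \<Sum>u\<in>X. form_scale (N (u, z)) (E u z)) (x, y)
        = (\<Sum>z\<in>X. \<Sum>u\<in>X. if y = z then if x = u then N (u, z) else 0 else 0)"
      unfolding sum_fun_apply by (intro sum.cong refl) (auto simp: E_def form_scale_def)
    also have "\<dots> = (\<Sum>z\<in>X. if y = z then \<Sum>u\<in>X. if x = u then N (u, z) else 0 else 0)"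
      by (intro sum.cong refl) auto
    also have "\<dots> = (if y \<in> X then if x \<in> X then N (x, y) else 0 else 0)"
      using assms(1) by simp
    finally show "N (x, y) = (\<Sum>z\<in>X. \<Sum>u\<in>X. form_scale (N (u, z)) (E u z)) (x, y)"
      using that by auto
  qed
  have P_expand: "P N (x, y) = (\<Sum>z\<in>X. \<Sum>u\<in>X. N (u, z) * T y z (x, u))"
    if "\<And>x y. x \<notin> X \<or> y \<notin> X \<Longrightarrow> N (x, y) = 0" for N x y
  proof -
    have "P N = P (\<Sum>z\<in>X. \<Sum>u\<in>X. form_scale (N (u, z)) (E u z))"
      using that by (intro arg_cong[where f = P] expand) auto
    also have "\<dots> = (\<Sum>z\<in>X. \<Sum>u\<in>X. form_scale (N (u, z)) (P (E u z)))"
      by (simp only: P.sum P.scale)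
    finally have "P N = (\<Sum>z\<in>X. \<Sum>u\<in>X. form_scale (N (u, z)) (P (E u z)))" .
    then show ?thesis by (simp add: sum_fun_apply form_scale_def T_def)
  qed
  have P_M: "P M (x, y) = M (x, y)" if "x \<in> X" "y \<in> X" for x y
  proof -
    let ?I = "permutation_matrix X id"
    have "P M (x, y) = (\<Sum>z\<in>X. \<Sum>u\<in>X. T y z (x, u) * M (u, z))"
      using P_expand[of M, OF supp] by (simp add: mult.commute)
    also have "\<dots> = (\<Sum>z\<in>X. \<Sum>u\<in>X. M (x, u) * T y z (u, z))"
    proof (rule sum.cong[OF refl])
      fix z assume z: "z \<in> X"
      show "(\<Sum>u\<in>X. T y z (x, u) * M (u, z)) = (\<Sum>u\<in>X. M (x, u) * T y z (u, z))"
        by (rule comm[of "T y z", symmetric]) (use T_sym that(1) z in auto)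
    qed
    also have "\<dots> = (\<Sum>u\<in>X. M (x, u) * (\<Sum>z\<in>X. T y z (u, z)))"
      by (subst sum.swap) (simp add: sum_distrib_left)
    also have "\<dots> = (\<Sum>u\<in>X. M (x, u) * P ?I (u, y))"
    proof (intro sum.cong refl arg_cong2[where f = "(*)"])
      fix u
      have "P ?I (u, y) = (\<Sum>z\<in>X. \<Sum>v\<in>X. ?I (v, z) * T y z (u, v))"
        by (rule P_expand) (auto simp: permutation_matrix_def)
      also have "\<dots> = (\<Sum>z\<in>X. \<Sum>v\<in>X. if z = v then T y z (u, v) else 0)"
        by (intro sum.cong refl) (auto simp: permutation_matrix_def)
      also have "\<dots> = (\<Sum>z\<in>X. T y z (u, z))" using assms(1) by simp
      finally show "(\<Sum>z\<in>X. T y z (u, z)) = P ?I (u, y)" by simp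
    qed
    also have "P ?I = ?I" using assms(3) by (intro P_id form.span_base) auto
    also have "(\<Sum>u\<in>X. M (x, u) * ?I (u, y)) = (\<Sum>u\<in>X. if u = y then M (x, u) else 0)"
      using that by (intro sum.cong refl) (auto simp: permutation_matrix_def)
    also have "\<dots> = M (x, y)" using assms(1) that by simp
    finally show ?thesis .
  qed
  have supp_A: "N (x, y) = 0" if "N \<in> ?A" "x \<notin> X \<or> y \<notin> X" for N x y
    using that(1)
  proof (induction rule: form.span_induct_alt)
    case (step c N N')
    then show ?case using that(2) by (auto simp: form_scale_def permutation_matrix_def)
  qed simp
  have "P M = M"
  proof (rule ext, clarify)
    fix x y show "P M (x, y) = M (x, y)"
      using P_M supp supp_A[OF P_in] by (cases "x \<in> X \<and> y \<in> X") auto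
  qed
  then show ?thesis using P_in by metis
qed

section \<open>Multilinear forms in coordinates\<close>

locale finite_dimensional_complex_space = finite_dimensional_vector_space scale Basis
  for scale :: "complex \<Rightarrow> 'v::ab_group_add \<Rightarrow> 'v" and Basis :: "'v set"
begin

abbreviation words :: "nat \<Rightarrow> (nat \<Rightarrow> 'v) set" where
  "words p \<equiv> {1..p} \<rightarrow>\<^sub>E Basis"

abbreviation coord :: "'v \<Rightarrow> 'v \<Rightarrow> complex" where
  "coord b v \<equiv> representation Basis v b"

text \<open>
  The tuple of coordinate functionals of the letters of a word, so that pairs \<open>(coords p I, J)\<close>
  are the points at which the matrix entries of a form are read off.
\<close>

definition coords :: "nat \<Rightarrow> (nat \<Rightarrow> 'v) \<Rightarrow> nat \<Rightarrow> 'v \<Rightarrow> complex" where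
  "coords p I = (\<lambda>i\<in>{1..p}. coord (I i))"

abbreviation perm_form :: "nat \<Rightarrow> (nat \<Rightarrow> nat) \<Rightarrow> 'v args \<Rightarrow> complex" where
  "perm_form p \<sigma> \<equiv> diagram_form scale p (permutation_diagram p \<sigma>)"

lemma finite_words: "finite (words p)"
  by (intro finite_PiE) (auto simp: finite_Basis)

lemma word_compose_iff:
  assumes "\<sigma> permutes {1..p}"
  shows "J \<circ> \<sigma> \<in> words p \<longleftrightarrow> J \<in> words p"
proof -
  have *: "J \<circ> \<sigma> \<in> words p" if "J \<in> words p" "\<sigma> permutes {1..p}" for J and \<sigma> :: "nat \<Rightarrow> nat"
  proof (rule PiE_I)
    fix i assume "i \<in> {1..p}"
    then have "\<sigma> i \<in> {1..p}" using permutes_in_image[OF that(2)] by blast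
    then show "(J \<circ> \<sigma>) i \<in> Basis" using that(1) by (auto simp: PiE_iff)
  next
    fix i assume "i \<notin> {1..p}"
    then show "(J \<circ> \<sigma>) i = undefined"
      using that(1) permutes_not_in[OF that(2)] PiE_arb[OF that(1)] by simp
  qed
  have "J \<circ> \<sigma> \<circ> inv \<sigma> = J" using permutes_inv_o(1)[OF assms] by (simp add: o_assoc[symmetric])
  then show ?thesis using *[of J \<sigma>] *[of "J \<circ> \<sigma>" "inv \<sigma>"] assms permutes_inv[OF assms] by auto
qed

lemma coord_dual: "coord b \<in> dual scale"
  by (simp add: dual_def coordinate_linear)

lemma coord_basis: "b \<in> Basis \<Longrightarrow> coord a b = (if a = b then 1 else 0)"
  by (simp add: representation_basis independent_Basis eq_commute)

lemma vector_eq_zero_iff_coord: "v = 0 \<longleftrightarrow> (\<forall>b\<in>Basis. coord b v = 0)"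
proof
  assume "\<forall>b\<in>Basis. coord b v = 0"
  moreover have "(\<Sum>b\<in>Basis. scale (coord b v) b) = v"
    by (rule sum_representation_eq) (auto simp: independent_Basis span_Basis finite_Basis)
  ultimately show "v = 0" by (metis (mono_tags, lifting) scale_zero_left sum.neutral)
qed (simp add: representation_zero)

lemma word_args: "J \<in> words q \<Longrightarrow> (coords p I, J) \<in> args scale p q"
  by (auto simp: args_def coords_def coord_dual)

lemma prod_coord_words:
  assumes "I \<in> words p" "J \<in> words p"
  shows "(\<Prod>i=1..p. coord (I i) (J i)) = (if I = J then 1 else 0)"
proof (cases "I = J")
  case True
  then show ?thesis using assms(2) by (auto simp: PiE_iff coord_basis intro!: prod.neutral)
next
  case False
  then obtain i where "i \<in> {1..p}" "I i \<noteq> J i" using assms by (metis PiE_ext)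
  moreover from this have "coord (I i) (J i) = 0" using assms(2) by (auto simp: PiE_iff coord_basis)
  ultimately have "\<exists>i\<in>{1..p}. coord (I i) (J i) = 0" by blast
  then show ?thesis using False by (simp add: prod_zero)
qed

lemma tensor_space_eq: "tensor_space scale p q = multilinear_forms scale p q"
  by (rule tensor_space_eq_multilinear_forms[OF finite_dimensional_vector_space_axioms])

lemma multilinear_form_expansion:
  assumes "F \<in> multilinear_forms scale p q" "(\<alpha>, w) \<in> args scale p q"
  shows "F (\<alpha>, w) = (\<Sum>I\<in>words p. \<Sum>J\<in>words q.
           (\<Prod>i=1..p. \<alpha> i (I i)) * (\<Prod>j=1..q. coord (J j) (w j)) * F (coords p I, J))"
proof -
  have "vector_space ((*) :: complex \<Rightarrow> complex \<Rightarrow> complex)"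
    by unfold_locales (auto simp: algebra_simps)
  then show ?thesis
    using multilinear_map_expansion[OF finite_dimensional_vector_space_axioms, of "(*)" p q F \<alpha> w] assms
    by (simp add: multilinear_forms_def coords_def)
qed

lemma multilinear_form_eqI:
  assumes "F \<in> multilinear_forms scale p q" "F' \<in> multilinear_forms scale p q"
    and "\<And>I J. I \<in> words p \<Longrightarrow> J \<in> words q \<Longrightarrow> F (coords p I, J) = F' (coords p I, J)"
  shows "F = F'"
proof (rule ext, clarify)
  fix \<alpha> w
  show "F (\<alpha>, w) = F' (\<alpha>, w)"
  proof (cases "(\<alpha>, w) \<in> args scale p q")
    case True
    show ?thesis
      unfolding multilinear_form_expansion[OF assms(1) True] multilinear_form_expansion[OF assms(2) True]
      by (intro sum.cong refl) (simp add: assms(3))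
  next
    case False
    then show ?thesis using assms(1,2) by (simp add: multilinear_forms_def)
  qed
qed

section \<open>Permutation diagrams as invariant forms\<close>

lemma perm_form_eval:
  "(\<alpha>, w) \<in> args scale p p \<Longrightarrow> perm_form p \<sigma> (\<alpha>, w) = (\<Prod>i=1..p. \<alpha> i (w (\<sigma> i)))"
proof -
  assume "(\<alpha>, w) \<in> args scale p p"
  moreover have "inj_on (\<lambda>i. (i, \<sigma> i)) {1..p}" by (rule inj_onI) simp
  ultimately show ?thesis
    unfolding diagram_form_def permutation_diagram_def
    by (simp add: prod_unfold_prod_mset[symmetric] prod.reindex contraction_def)
qed

lemma perm_form_coords:
  assumes "\<sigma> permutes {1..p}" "I \<in> words p" "J \<in> words p"
  shows "perm_form p \<sigma> (coords p I, J) = (if I = J \<circ> \<sigma> then 1 else 0)"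
proof -
  have "perm_form p \<sigma> (coords p I, J) = (\<Prod>i=1..p. coord (I i) ((J \<circ> \<sigma>) i))"
    by (subst perm_form_eval[OF word_args[OF assms(3)]]) (simp add: coords_def)
  also have "\<dots> = (if I = J \<circ> \<sigma> then 1 else 0)"
    using assms word_compose_iff[of \<sigma> p J] by (intro prod_coord_words) blast+
  finally show ?thesis .
qed

lemma perm_form_multilinear:
  assumes "\<sigma> permutes {1..p}"
  shows "perm_form p \<sigma> \<in> multilinear_forms scale p p"
proof -
  have dual_cl: "(\<lambda>x. a x + b x) \<in> dual scale" "(\<lambda>x. c * a x) \<in> dual scale"
    if "a \<in> dual scale" "b \<in> dual scale" for a b c
    using that by (auto simp: dual_def Vector_Spaces.linear_iff algebra_simps)
  have upd1: "(\<alpha>(i := a), w) \<in> args scale p p"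
    if "(\<alpha>, w) \<in> args scale p p" "i \<in> {1..p}" "a \<in> dual scale" for \<alpha> w i a
    using that by (auto simp: args_def PiE_iff extensional_def)
  have upd2: "(\<alpha>, w(j := v)) \<in> args scale p p"
    if "(\<alpha>, w) \<in> args scale p p" "j \<in> {1..p}" for \<alpha> w j v
    using that by (auto simp: args_def PiE_iff extensional_def)
  have t1: "perm_form p \<sigma> (\<alpha>(i := a), w) = a (w (\<sigma> i)) * (\<Prod>k\<in>{1..p}-{i}. \<alpha> k (w (\<sigma> k)))"
    if "(\<alpha>, w) \<in> args scale p p" "i \<in> {1..p}" "a \<in> dual scale" for \<alpha> w i a
    unfolding perm_form_eval[OF upd1[OF that]]
    by (rule prod_upd_slot[OF that(2), of "\<lambda>k f. f (w (\<sigma> k))" \<alpha> a])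
  have t2: "perm_form p \<sigma> (\<alpha>, w(j := v)) =
        \<alpha> (inv \<sigma> j) v * (\<Prod>k\<in>{1..p}-{j}. \<alpha> (inv \<sigma> k) (w k))"
    if "(\<alpha>, w) \<in> args scale p p" "j \<in> {1..p}" for \<alpha> w j v
  proof -
    have "(\<Prod>i=1..p. \<alpha> i ((w(j := v)) (\<sigma> i))) = (\<Prod>k=1..p. \<alpha> (inv \<sigma> k) ((w(j := v)) k))"
      by (rule prod.reindex_bij_witness[where i = "inv \<sigma>" and j = \<sigma>])
         (use permutes_in_image[OF assms] permutes_in_image[OF permutes_inv[OF assms]]
            permutes_inverses[OF assms] in simp_all)
    then show ?thesis
      unfolding perm_form_eval[OF upd2[OF that]]
      using prod_upd_slot[OF that(2), of "\<lambda>k. \<alpha> (inv \<sigma> k)" w v] by simp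
  qed
  have "multilinear_map scale (*) p p (perm_form p \<sigma>)"
    unfolding multilinear_map_def
  proof (intro allI impI conjI ballI)
    fix \<alpha> w j
    assume *: "(\<alpha>, w) \<in> args scale p p" "j \<in> {1..p}"
    then have "inv \<sigma> j \<in> {1..p}" using permutes_in_image[OF permutes_inv[OF assms]] by blast
    then have "Vector_Spaces.linear scale (*) (\<alpha> (inv \<sigma> j))"
      using *(1) by (auto simp: args_def dual_def PiE_iff)
    then show "Vector_Spaces.linear scale (*) (\<lambda>x. perm_form p \<sigma> (\<alpha>, w(j := x)))"
      using * by (simp add: t2 Vector_Spaces.linear_iff algebra_simps)
  qed (simp_all add: t1 dual_cl algebra_simps)
  then show ?thesis
    by (auto simp: multilinear_forms_def diagram_form_def)
qed

lemma GL_args: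
  assumes "g \<in> GL scale" "(\<alpha>, w) \<in> args scale p q"
  shows "(\<lambda>i\<in>{1..p}. \<alpha> i \<circ> g, \<lambda>j\<in>{1..q}. h (w j)) \<in> args scale p q"
  using assms by (auto simp: args_def GL_def intro!: dual_compose)

lemma perm_form_invariant:
  assumes "\<sigma> permutes {1..p}"
  shows "perm_form p \<sigma> \<in> gl_invariants scale p p"
proof -
  have "gl_act scale p p g (perm_form p \<sigma>) = perm_form p \<sigma>" if g: "g \<in> GL scale" for g
  proof (rule ext, clarify)
    fix \<alpha> w
    have gi: "g (inv g v) = v" for v
      using g by (simp add: GL_def bij_is_surj surj_f_inv_f)
    show "gl_act scale p p g (perm_form p \<sigma>) (\<alpha>, w) = perm_form p \<sigma> (\<alpha>, w)"
    proof (cases "(\<alpha>, w) \<in> args scale p p")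
      case True
      have "gl_act scale p p g (perm_form p \<sigma>) (\<alpha>, w)
          = (\<Prod>i=1..p. (\<lambda>i\<in>{1..p}. \<alpha> i \<circ> g) i ((\<lambda>j\<in>{1..p}. inv g (w j)) (\<sigma> i)))"
        using True by (simp only: gl_act_def perm_form_eval[OF GL_args[OF g True]] case_prod_conv if_True)
      also have "\<dots> = (\<Prod>i=1..p. \<alpha> i (w (\<sigma> i)))"
      proof (rule prod.cong[OF refl])
        fix i assume i: "i \<in> {1..p}"
        then have "\<sigma> i \<in> {1..p}" using permutes_in_image[OF assms] by blast
        then show "(\<lambda>i\<in>{1..p}. \<alpha> i \<circ> g) i ((\<lambda>j\<in>{1..p}. inv g (w j)) (\<sigma> i)) = \<alpha> i (w (\<sigma> i))"
          using i by (simp add: gi)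
      qed
      finally show ?thesis by (simp add: perm_form_eval[OF True])
    next
      case False
      then show ?thesis by (simp add: gl_act_def diagram_form_def)
    qed
  qed
  then show ?thesis
    using perm_form_multilinear[OF assms] by (simp add: gl_invariants_def tensor_space_eq)
qed

lemma gl_invariants_subspace: "form.subspace (gl_invariants scale p q)"
proof -
  have "form.subspace (tensor_space scale p q)"
    unfolding tensor_space_def by (rule form.subspace_span)
  moreover have "gl_act scale p q g 0 = 0"
    "gl_act scale p q g (F + F') = gl_act scale p q g F + gl_act scale p q g F'"
    "gl_act scale p q g (form_scale c F) = form_scale c (gl_act scale p q g F)" for g F F' c
    by (auto simp: gl_act_def form_scale_def fun_eq_iff)
  ultimately show ?thesis
    by (auto simp: form.subspace_def gl_invariants_def)
qed

text \<open>
  The scalar \<open>2\<close> multiplies every form by \<open>2 ^ p * (1 / 2) ^ q\<close>.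
\<close>

lemma gl_invariants_eq_zero_if_degrees_differ:
  assumes "p \<noteq> q"
  shows "gl_invariants scale p q = {0}"
proof -
  have "F = 0" if F: "F \<in> gl_invariants scale p q" for F
  proof (rule ext, clarify)
    fix \<alpha> w
    have Fm: "F \<in> multilinear_forms scale p q" using F by (simp add: gl_invariants_def tensor_space_eq)
    show "F (\<alpha>, w) = 0 (\<alpha>, w)"
    proof (cases "(\<alpha>, w) \<in> args scale p q")
      case True
      let ?g = "scale 2"
      have inv: "inv ?g = scale (1 / 2)" by (rule inv_equality) simp_all
      have "bij ?g" by (rule o_bij[of "scale (1 / 2)"]) (simp_all add: fun_eq_iff)
      moreover have "Vector_Spaces.linear scale scale ?g"
        by (simp add: Vector_Spaces.linear_iff vector_space_axioms scale_right_distrib scale_left_commute)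
      ultimately have g: "?g \<in> GL scale" by (simp add: GL_def)
      let ?x = "(\<lambda>i\<in>{1..p}. \<alpha> i \<circ> ?g, \<lambda>j\<in>{1..q}. inv ?g (w j))"
      have lin: "\<alpha> i (scale c v) = c * \<alpha> i v" if "i \<in> {1..p}" for i c v
        using True that by (auto simp: args_def dual_def Vector_Spaces.linear_iff PiE_iff)
      have "F (\<alpha>, w) = F ?x"
      proof -
        have "gl_act scale p q ?g F = F" using F g by (simp add: gl_invariants_def)
        then have "F (\<alpha>, w) = gl_act scale p q ?g F (\<alpha>, w)" by simp
        then show ?thesis using True by (simp only: gl_act_def case_prod_conv if_True)
      qed
      also have "\<dots> = (\<Sum>I\<in>words p. \<Sum>J\<in>words q. 2 ^ p * (1 / 2) ^ q *
          ((\<Prod>i=1..p. \<alpha> i (I i)) * (\<Prod>j=1..q. coord (J j) (w j)) * F (coords p I, J)))"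
        unfolding multilinear_form_expansion[OF Fm GL_args[OF g True]]
      proof (intro sum.cong refl)
        fix I J
        have "(\<Prod>i=1..p. (\<lambda>i\<in>{1..p}. \<alpha> i \<circ> ?g) i (I i)) = 2 ^ p * (\<Prod>i=1..p. \<alpha> i (I i))"
          using prod.distrib[of "\<lambda>_. 2" "\<lambda>i. \<alpha> i (I i)" "{1..p}"] by (simp add: lin)
        moreover have "(\<Prod>j=1..q. coord (J j) ((\<lambda>j\<in>{1..q}. inv ?g (w j)) j))
            = (1 / 2) ^ q * (\<Prod>j=1..q. coord (J j) (w j))"
          using prod.distrib[of "\<lambda>_. 1 / 2" "\<lambda>j. coord (J j) (w j)" "{1..q}"]
          by (simp add: inv representation_scale independent_Basis span_Basis)
        ultimately show "(\<Prod>i=1..p. (\<lambda>i\<in>{1..p}. \<alpha> i \<circ> ?g) i (I i)) *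
            (\<Prod>j=1..q. coord (J j) ((\<lambda>j\<in>{1..q}. inv ?g (w j)) j)) * F (coords p I, J)
          = 2 ^ p * (1 / 2) ^ q * ((\<Prod>i=1..p. \<alpha> i (I i)) * (\<Prod>j=1..q. coord (J j) (w j)) * F (coords p I, J))"
          by (simp only: mult_ac)
      qed
      also have "\<dots> = 2 ^ p * (1 / 2) ^ q * F (\<alpha>, w)"
        unfolding multilinear_form_expansion[OF Fm True] by (simp only: sum_distrib_left)
      finally have "F (\<alpha>, w) * 2 ^ q = 2 ^ p * F (\<alpha>, w)"
        by (simp add: field_simps)
      moreover have "(2 :: complex) ^ q \<noteq> 2 ^ p"
      proof -
        have "(2 :: nat) ^ q \<noteq> 2 ^ p" using assms by simp
        then have "of_nat (2 ^ q) \<noteq> (of_nat (2 ^ p) :: complex)" by (simp only: of_nat_eq_iff not_False_eq_True)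
        then show ?thesis by simp
      qed
      ultimately show ?thesis by (auto simp: mult.commute)
    next
      case False
      then show ?thesis using Fm by (simp add: multilinear_forms_def)
    qed
  qed
  then show ?thesis using form.subspace_0[OF gl_invariants_subspace] by blast
qed

section \<open>Invariants are spanned by permutations\<close>

lemma sum_delta_words:
  assumes "J \<in> words p"
  shows "(\<Sum>K\<in>words p. if K = J then f K else (0 :: complex)) = f J"
    "(\<Sum>K\<in>words p. if J = K then f K else (0 :: complex)) = f J"
  using assms sum.delta[OF finite_words, of J f] sum.delta'[OF finite_words, of J f] by simp_all

text \<open>
  Invariance in the form \<open>F(\<alpha> \<circ> g, w) = F(\<alpha>, g w)\<close>, evaluated at basis covectors and basis vectors:
  the matrix of \<open>F\<close> commutes with the \<open>p\<close>-th tensor power of the matrix of \<open>g\<close>.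
\<close>

lemma gl_invariant_commutes_tensor_power:
  assumes F: "F \<in> gl_invariants scale p p" and g: "g \<in> GL scale" and I: "I \<in> words p" and J: "J \<in> words p"
  shows "(\<Sum>K\<in>words p. (\<Prod>i=1..p. coord (I i) (g (K i))) * F (coords p K, J))
       = (\<Sum>K\<in>words p. F (coords p I, K) * (\<Prod>i=1..p. coord (K i) (g (J i))))"
proof -
  have Fm: "F \<in> multilinear_forms scale p p" using F by (simp add: gl_invariants_def tensor_space_eq)
  let ?\<alpha> = "\<lambda>i\<in>{1..p}. coords p I i \<circ> g" and ?w = "\<lambda>j\<in>{1..p}. g (J j)"
  have w: "(coords p I, ?w) \<in> args scale p p" using word_args[OF I, of p] by (auto simp: args_def)
  have ig: "inv g (g v) = v" for v using g by (simp add: GL_def bij_is_inj)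
  have J': "(\<lambda>j\<in>{1..p}. inv g (?w j)) = J"
    using J by (auto simp: fun_eq_iff ig PiE_iff extensional_def)
  have \<alpha>: "(?\<alpha>, J) \<in> args scale p p" using GL_args[OF g w, of "inv g"] unfolding J' .
  have "gl_act scale p p g F = F" using F g by (simp add: gl_invariants_def)
  then have "F (coords p I, ?w) = gl_act scale p p g F (coords p I, ?w)" by simp
  then have eq: "F (?\<alpha>, J) = F (coords p I, ?w)"
    using w by (simp only: gl_act_def case_prod_conv if_True J')
  have "F (?\<alpha>, J) = (\<Sum>K\<in>words p. \<Sum>L\<in>words p. if L = J then
      (\<Prod>i=1..p. coord (I i) (g (K i))) * F (coords p K, L) else 0)"
    unfolding multilinear_form_expansion[OF Fm \<alpha>]
  proof (intro sum.cong refl)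
    fix K L assume L: "L \<in> words p"
    have "(\<Prod>i=1..p. ?\<alpha> i (K i)) = (\<Prod>i=1..p. coord (I i) (g (K i)))" by (simp add: coords_def)
    then show "(\<Prod>i=1..p. ?\<alpha> i (K i)) * (\<Prod>j=1..p. coord (L j) (J j)) * F (coords p K, L)
      = (if L = J then (\<Prod>i=1..p. coord (I i) (g (K i))) * F (coords p K, L) else 0)"
      by (simp only: prod_coord_words[OF L J]) simp
  qed
  then have 1: "F (?\<alpha>, J) = (\<Sum>K\<in>words p. (\<Prod>i=1..p. coord (I i) (g (K i))) * F (coords p K, J))"
    by (simp only: sum_delta_words[OF J])
  have "F (coords p I, ?w) = (\<Sum>K\<in>words p. \<Sum>L\<in>words p. if I = K then
      F (coords p K, L) * (\<Prod>i=1..p. coord (L i) (g (J i))) else 0)"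
    unfolding multilinear_form_expansion[OF Fm w]
  proof (intro sum.cong refl)
    fix K L assume "K \<in> words p" "L \<in> words p"
    moreover have "(\<Prod>i=1..p. coords p I i (K i)) = (\<Prod>i=1..p. coord (I i) (K i))"
      by (simp add: coords_def)
    moreover have "(\<Prod>j=1..p. coord (L j) (?w j)) = (\<Prod>i=1..p. coord (L i) (g (J i)))" by simp
    ultimately show "(\<Prod>i=1..p. coords p I i (K i)) * (\<Prod>j=1..p. coord (L j) (?w j)) * F (coords p K, L)
      = (if I = K then F (coords p K, L) * (\<Prod>i=1..p. coord (L i) (g (J i))) else 0)"
      by (simp only: prod_coord_words[OF I]) simp
  qed
  also have "\<dots> = (\<Sum>L\<in>words p. \<Sum>K\<in>words p. if I = K then
      F (coords p K, L) * (\<Prod>i=1..p. coord (L i) (g (J i))) else 0)"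
    by (rule sum.swap)
  finally have 2: "F (coords p I, ?w) = (\<Sum>K\<in>words p. F (coords p I, K) * (\<Prod>i=1..p. coord (K i) (g (J i))))"
    by (simp only: sum_delta_words[OF I])
  show ?thesis using eq 1 2 by simp
qed

lemma coord_linear:
  "coord b (u + v) = coord b u + coord b v" "coord b (scale c v) = c * coord b v"
  "coord b (sum f A) = (\<Sum>a\<in>A. coord b (f a))"
proof -
  interpret l: Vector_Spaces.linear scale "(*)" "coord b" by (rule coordinate_linear)
  show "coord b (u + v) = coord b u + coord b v" "coord b (scale c v) = c * coord b v"
    "coord b (sum f A) = (\<Sum>a\<in>A. coord b (f a))"
    by (rule l.add l.scale l.sum)+
qed

text \<open>
  The operator \<open>(p + 1) id + \<Sum>\<^sub>s E\<^bsub>a s, b s\<^esub>\<close>, where the matrix unit \<open>E\<^bsub>a, b\<^esub>\<close> sends the basis vector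
  \<open>b\<close> to \<open>a\<close>.  A sum of at most \<open>p\<close> matrix units has norm at most \<open>p\<close> for the sum norm of the
  coordinates, so the shift by \<open>p + 1\<close> makes the operator invertible.
\<close>

definition shifted_units :: "nat \<Rightarrow> (nat \<Rightarrow> 'v) \<Rightarrow> (nat \<Rightarrow> 'v) \<Rightarrow> nat set \<Rightarrow> 'v \<Rightarrow> 'v" where
  "shifted_units p a b S v = scale (of_nat (p + 1)) v + (\<Sum>s\<in>S. scale (coord (b s) v) (a s))"

lemma shifted_units_GL:
  assumes S: "S \<subseteq> {1..p}" and a: "a \<in> words p" and b: "b \<in> words p"
  shows "shifted_units p a b S \<in> GL scale"
proof -
  have finS: "finite S" using S finite_subset by blast
  have lin: "Vector_Spaces.linear scale scale (shifted_units p a b S)"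
    by (auto simp: Vector_Spaces.linear_iff vector_space_axioms shifted_units_def coord_linear
        scale_right_distrib scale_left_distrib sum.distrib scale_sum_right mult.commute
        simp del: of_nat_add of_nat_Suc)
  interpret l: Vector_Spaces.linear scale scale "shifted_units p a b S" by (rule lin)
  have "v = 0" if v: "shifted_units p a b S v = 0" for v
  proof -
    \<comment> \<open>From \<open>(p + 1) v = - \<Sum>\<^sub>s E\<^bsub>a s, b s\<^esub> v\<close> one gets \<open>(p + 1) N \<le> p N\<close> for the sum norm \<open>N\<close>.\<close>
    define N where "N = (\<Sum>x\<in>Basis. cmod (coord x v))"
    have le: "real (p + 1) * cmod (coord x v) \<le> (\<Sum>s\<in>S. if x = a s then cmod (coord (b s) v) else 0)"
      if x: "x \<in> Basis" for x
    proof -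
      have "coord x (shifted_units p a b S v) = 0" using v by (simp add: representation_zero)
      then have "of_nat (p + 1) * coord x v = - (\<Sum>s\<in>S. coord (b s) v * coord x (a s))"
        unfolding shifted_units_def coord_linear by (simp add: eq_neg_iff_add_eq_0)
      then have "cmod (of_nat (p + 1) * coord x v) = cmod (\<Sum>s\<in>S. coord (b s) v * coord x (a s))"
        by (simp only: norm_minus_cancel)
      also have "\<dots> \<le> (\<Sum>s\<in>S. cmod (coord (b s) v * coord x (a s)))" by (rule norm_sum)
      also have "\<dots> = (\<Sum>s\<in>S. if x = a s then cmod (coord (b s) v) else 0)"
      proof (rule sum.cong[OF refl])
        fix s assume "s \<in> S"
        then have "a s \<in> Basis" using S a by (auto simp: PiE_iff)
        then show "cmod (coord (b s) v * coord x (a s)) = (if x = a s then cmod (coord (b s) v) else 0)"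
          by (simp add: coord_basis)
      qed
      finally show ?thesis by (simp only: norm_mult norm_of_nat)
    qed
    have "real (p + 1) * N \<le> (\<Sum>x\<in>Basis. \<Sum>s\<in>S. if x = a s then cmod (coord (b s) v) else 0)"
      unfolding N_def sum_distrib_left by (intro sum_mono le)
    also have "\<dots> = (\<Sum>s\<in>S. \<Sum>x\<in>Basis. if x = a s then cmod (coord (b s) v) else 0)"
      by (rule sum.swap)
    also have "\<dots> = (\<Sum>s\<in>S. cmod (coord (b s) v))"
      using S a by (intro sum.cong refl) (auto simp: finite_Basis PiE_iff)
    also have "\<dots> \<le> (\<Sum>s\<in>S. N)"
      unfolding N_def
    proof (intro sum_mono member_le_sum)
      fix s assume "s \<in> S"
      then show "b s \<in> Basis" using S b by (auto simp: PiE_iff)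
    qed (auto simp: finite_Basis)
    also have "\<dots> \<le> real p * N"
    proof -
      have "card S \<le> p" using card_mono[OF _ S] by simp
      moreover have "N \<ge> 0" by (simp add: N_def sum_nonneg)
      ultimately show ?thesis by (simp add: mult_right_mono)
    qed
    finally have "N \<le> 0" by (simp add: algebra_simps)
    then have "N = 0" by (simp add: N_def sum_nonneg order_antisym)
    then have "\<forall>x\<in>Basis. coord x v = 0"
      by (simp add: N_def sum_nonneg_eq_0_iff finite_Basis)
    then show ?thesis by (simp add: vector_eq_zero_iff_coord)
  qed
  then have "inj (shifted_units p a b S)"
    by (subst l.inj_iff_eq_0) blast
  moreover from this have "surj (shifted_units p a b S)" by (rule linear_inj_imp_surj[OF lin])
  ultimately show ?thesis using lin by (simp add: GL_def bij_def)
qed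

text \<open>
  The shifted Ryser formula for the array \<open>y i s = [I i = a s] [K i = b s]\<close> and the shift
  \<open>z i = (p + 1) [I i = K i]\<close>, for which \<open>z i + (\<Sum>s\<in>S. y i s)\<close> is a matrix entry of
  \<open>shifted_units p a b S\<close>.
\<close>

lemma sum_over_permutations_as_tensor_powers:
  assumes "a \<in> words p" "b \<in> words p" "I \<in> words p" "K \<in> words p"
  shows "(\<Sum>\<sigma> | \<sigma> permutes {1..p}. if I = a \<circ> \<sigma> \<and> K = b \<circ> \<sigma> then 1 else 0)
       = (\<Sum>S | S \<subseteq> {1..p}. (- 1) ^ (p - card S) * (\<Prod>i=1..p. coord (I i) (shifted_units p a b S (K i))))"
proof -
  have eq: "I = a \<circ> \<sigma> \<longleftrightarrow> (\<forall>i\<in>{1..p}. I i = a (\<sigma> i))" if "\<sigma> permutes {1..p}" "I \<in> words p" "a \<in> words p" for \<sigma> I a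
    using word_compose_iff[OF that(1), of a] that(2,3) by (metis PiE_ext comp_apply)
  have "(\<Sum>\<sigma> | \<sigma> permutes {1..p}. if I = a \<circ> \<sigma> \<and> K = b \<circ> \<sigma> then 1 else 0)
      = (\<Sum>\<sigma> | \<sigma> permutes {1..p}. \<Prod>i=1..p. if I i = a (\<sigma> i) \<and> K i = b (\<sigma> i) then 1 else 0 :: complex)"
  proof (intro sum.cong refl)
    fix \<sigma> assume "\<sigma> \<in> {\<sigma>. \<sigma> permutes {1..p}}"
    then have "I = a \<circ> \<sigma> \<and> K = b \<circ> \<sigma> \<longleftrightarrow> (\<forall>i\<in>{1..p}. I i = a (\<sigma> i) \<and> K i = b (\<sigma> i))"
      using eq[of \<sigma> I a] eq[of \<sigma> K b] assms by blast
    then show "(if I = a \<circ> \<sigma> \<and> K = b \<circ> \<sigma> then 1 else 0)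
        = (\<Prod>i=1..p. if I i = a (\<sigma> i) \<and> K i = b (\<sigma> i) then 1 else 0 :: complex)"
      by (cases "\<forall>i\<in>{1..p}. I i = a (\<sigma> i) \<and> K i = b (\<sigma> i)") (simp, auto intro!: prod_zero[symmetric])
  qed
  also have "\<dots> = (\<Sum>S | S \<subseteq> {1..p}. (- 1) ^ (p - card S) *
      (\<Prod>i=1..p. (if I i = K i then of_nat (p + 1) else 0) + (\<Sum>s\<in>S. if I i = a s \<and> K i = b s then 1 else 0)))"
    by (rule shifted_ryser[symmetric])
  also have "\<dots> = (\<Sum>S | S \<subseteq> {1..p}. (- 1) ^ (p - card S) * (\<Prod>i=1..p. coord (I i) (shifted_units p a b S (K i))))"
  proof (intro sum.cong prod.cong arg_cong2[where f = "(*)"] refl)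
    fix S i assume S: "S \<in> {S. S \<subseteq> {1..p}}" and i: "i \<in> {1..p}"
    have Ki: "K i \<in> Basis" using assms(4) i by (auto simp: PiE_iff)
    have "(\<Sum>s\<in>S. if I i = a s \<and> K i = b s then 1 else 0) = (\<Sum>s\<in>S. coord (b s) (K i) * coord (I i) (a s))"
    proof (rule sum.cong[OF refl])
      fix s assume "s \<in> S"
      then have "a s \<in> Basis" using S assms(1) by (auto simp: PiE_iff)
      then show "(if I i = a s \<and> K i = b s then 1 else 0) = coord (b s) (K i) * coord (I i) (a s)"
        using Ki by (auto simp: coord_basis)
    qed
    then show "(if I i = K i then of_nat (p + 1) else 0) + (\<Sum>s\<in>S. if I i = a s \<and> K i = b s then 1 else 0)
        = coord (I i) (shifted_units p a b S (K i))"
      using Ki by (simp add: shifted_units_def coord_linear coord_basis)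
  qed
  finally show ?thesis .
qed

lemma gl_invariant_commutes_orbit_sum:
  assumes F: "F \<in> gl_invariants scale p p" and "a \<in> words p" "b \<in> words p" and I: "I \<in> words p" and J: "J \<in> words p"
  defines "Orb \<equiv> \<lambda>I K. \<Sum>\<sigma> | \<sigma> permutes {1..p}. if I = a \<circ> \<sigma> \<and> K = b \<circ> \<sigma> then 1 else (0 :: complex)"
  shows "(\<Sum>K\<in>words p. Orb I K * F (coords p K, J)) = (\<Sum>K\<in>words p. F (coords p I, K) * Orb K J)"
proof -
  let ?g = "\<lambda>S I K. \<Prod>i=1..p. coord (I i) (shifted_units p a b S (K i))"
  have Orb: "Orb I K = (\<Sum>S | S \<subseteq> {1..p}. (- 1) ^ (p - card S) * ?g S I K)" if "I \<in> words p" "K \<in> words p" for I K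
    unfolding Orb_def by (rule sum_over_permutations_as_tensor_powers[OF assms(2,3) that])
  have "(\<Sum>K\<in>words p. Orb I K * F (coords p K, J))
      = (\<Sum>K\<in>words p. \<Sum>S | S \<subseteq> {1..p}. (- 1) ^ (p - card S) * (?g S I K * F (coords p K, J)))"
    by (intro sum.cong refl) (simp only: Orb[OF I] sum_distrib_right mult.assoc)
  also have "\<dots> = (\<Sum>S | S \<subseteq> {1..p}. (- 1) ^ (p - card S) * (\<Sum>K\<in>words p. ?g S I K * F (coords p K, J)))"
    by (subst sum.swap) (simp add: sum_distrib_left)
  also have "\<dots> = (\<Sum>S | S \<subseteq> {1..p}. (- 1) ^ (p - card S) * (\<Sum>K\<in>words p. F (coords p I, K) * ?g S K J))"
  proof (rule sum.cong[OF refl])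
    fix S assume "S \<in> {S. S \<subseteq> {1..p}}"
    then have "shifted_units p a b S \<in> GL scale" using shifted_units_GL assms(2,3) by simp
    then show "(- 1) ^ (p - card S) * (\<Sum>K\<in>words p. ?g S I K * F (coords p K, J))
        = (- 1) ^ (p - card S) * (\<Sum>K\<in>words p. F (coords p I, K) * ?g S K J)"
      by (simp only: gl_invariant_commutes_tensor_power[OF F _ I J])
  qed
  also have "\<dots> = (\<Sum>K\<in>words p. \<Sum>S | S \<subseteq> {1..p}. F (coords p I, K) * ((- 1) ^ (p - card S) * ?g S K J))"
    by (subst sum.swap) (simp add: sum_distrib_left mult_ac)
  also have "\<dots> = (\<Sum>K\<in>words p. F (coords p I, K) * Orb K J)"
    by (intro sum.cong refl) (simp only: Orb[OF _ J] sum_distrib_left)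
  finally show ?thesis .
qed

text \<open>
  Up to the factor \<open>p!\<close>, a symmetric matrix is the combination of orbit sums with its own entries as
  coefficients.
\<close>

lemma symmetric_matrix_eq_orbit_sums:
  assumes T: "\<And>\<sigma> I J. \<sigma> permutes {1..p} \<Longrightarrow> T (I \<circ> \<sigma>, J \<circ> \<sigma>) = (T (I, J) :: complex)"
    and I: "I \<in> words p" and K: "K \<in> words p"
  shows "(\<Sum>a\<in>words p. \<Sum>b\<in>words p. T (a, b) * (\<Sum>\<sigma> | \<sigma> permutes {1..p}. if I = a \<circ> \<sigma> \<and> K = b \<circ> \<sigma> then 1 else 0))
       = fact p * T (I, K)"
proof -
  let ?P = "{\<sigma>. \<sigma> permutes {1..p}}"
  have "(\<Sum>a\<in>words p. \<Sum>b\<in>words p. T (a, b) * (\<Sum>\<sigma>\<in>?P. if I = a \<circ> \<sigma> \<and> K = b \<circ> \<sigma> then 1 else 0))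
      = (\<Sum>(a, b)\<in>words p \<times> words p. \<Sum>\<sigma>\<in>?P. if I = a \<circ> \<sigma> \<and> K = b \<circ> \<sigma> then T (a, b) else 0)"
    unfolding sum.cartesian_product[of _ "words p"]
    by (intro sum.cong refl) (auto simp: sum_distrib_left intro!: sum.cong)
  also have "\<dots> = (\<Sum>\<sigma>\<in>?P. \<Sum>(a, b)\<in>words p \<times> words p. if I = a \<circ> \<sigma> \<and> K = b \<circ> \<sigma> then T (a, b) else 0)"
    unfolding split_def by (rule sum.swap)
  also have "\<dots> = (\<Sum>\<sigma>\<in>?P. T (I, K))"
  proof (rule sum.cong[OF refl])
    fix \<sigma> assume "\<sigma> \<in> ?P"
    then have \<sigma>: "\<sigma> permutes {1..p}" by simp
    have inv: "I = a \<circ> \<sigma> \<longleftrightarrow> a = I \<circ> inv \<sigma>" for I a :: "nat \<Rightarrow> 'v"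
      using permutes_inv_o[OF \<sigma>] by (auto simp: o_assoc[symmetric])
    have "(\<Sum>(a, b)\<in>words p \<times> words p. if I = a \<circ> \<sigma> \<and> K = b \<circ> \<sigma> then T (a, b) else 0)
        = (\<Sum>x\<in>words p \<times> words p. if x = (I \<circ> inv \<sigma>, K \<circ> inv \<sigma>) then T x else 0)"
      by (intro sum.cong refl) (simp add: inv split: prod.split)
    also have "\<dots> = T (I \<circ> inv \<sigma>, K \<circ> inv \<sigma>)"
    proof -
      have "(I \<circ> inv \<sigma>, K \<circ> inv \<sigma>) \<in> words p \<times> words p"
        using word_compose_iff[OF permutes_inv[OF \<sigma>]] I K by blast
      then show ?thesis
        by (simp only: sum.delta[OF finite_cartesian_product[OF finite_words finite_words]] if_True)
    qed
    also have "\<dots> = T (I, K)" by (rule T[OF permutes_inv[OF \<sigma>]])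
    finally show "(\<Sum>(a, b)\<in>words p \<times> words p. if I = a \<circ> \<sigma> \<and> K = b \<circ> \<sigma> then T (a, b) else 0) = T (I, K)" .
  qed
  also have "\<dots> = fact p * T (I, K)"
    using card_permutations[of "{1..p}" p] by simp
  finally show ?thesis .
qed

text \<open>
  The matrices \<open>T\<close> that are constant on the orbits of pairs of words are the commutant of the
  permutation action, so this is the input for the double commutant theorem.
\<close>

lemma gl_invariant_commutes_symmetric:
  assumes F: "F \<in> gl_invariants scale p p"
    and T: "\<And>\<sigma> I J. \<sigma> permutes {1..p} \<Longrightarrow> T (I \<circ> \<sigma>, J \<circ> \<sigma>) = (T (I, J) :: complex)"
    and I: "I \<in> words p" and J: "J \<in> words p"
  shows "(\<Sum>K\<in>words p. F (coords p I, K) * T (K, J)) = (\<Sum>K\<in>words p. T (I, K) * F (coords p K, J))"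
proof -
  define Orb where "Orb a b I K = (\<Sum>\<sigma> | \<sigma> permutes {1..p}. if I = a \<circ> \<sigma> \<and> K = b \<circ> \<sigma> then 1 else (0 :: complex))"
    for a b I K :: "nat \<Rightarrow> 'v"
  have TO: "fact p * T (I, K) = (\<Sum>a\<in>words p. \<Sum>b\<in>words p. T (a, b) * Orb a b I K)"
    if "I \<in> words p" "K \<in> words p" for I K
    unfolding Orb_def by (rule symmetric_matrix_eq_orbit_sums[OF T that, symmetric])
  have "fact p * (\<Sum>K\<in>words p. F (coords p I, K) * T (K, J))
      = (\<Sum>K\<in>words p. \<Sum>(a, b)\<in>words p \<times> words p. T (a, b) * (F (coords p I, K) * Orb a b K J))"
    unfolding sum_distrib_left
  proof (rule sum.cong[OF refl])
    fix K assume K: "K \<in> words p"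
    have "fact p * (F (coords p I, K) * T (K, J)) = F (coords p I, K) * (fact p * T (K, J))" by simp
    then show "fact p * (F (coords p I, K) * T (K, J))
        = (\<Sum>(a, b)\<in>words p \<times> words p. T (a, b) * (F (coords p I, K) * Orb a b K J))"
      by (simp only: TO[OF K J] sum.cartesian_product sum_distrib_left split_def mult.left_commute)
  qed
  also have "\<dots> = (\<Sum>(a, b)\<in>words p \<times> words p. T (a, b) * (\<Sum>K\<in>words p. F (coords p I, K) * Orb a b K J))"
    by (subst sum.swap) (simp add: sum_distrib_left split_def)
  also have "\<dots> = (\<Sum>(a, b)\<in>words p \<times> words p. T (a, b) * (\<Sum>K\<in>words p. Orb a b I K * F (coords p K, J)))"
    unfolding Orb_def using gl_invariant_commutes_orbit_sum[OF F _ _ I J]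
    by (intro sum.cong refl) auto
  also have "\<dots> = (\<Sum>K\<in>words p. \<Sum>(a, b)\<in>words p \<times> words p. T (a, b) * (Orb a b I K * F (coords p K, J)))"
    by (subst sum.swap) (simp add: sum_distrib_left split_def)
  also have "\<dots> = fact p * (\<Sum>K\<in>words p. T (I, K) * F (coords p K, J))"
    unfolding sum_distrib_left
  proof (rule sum.cong[OF refl])
    fix K assume K: "K \<in> words p"
    have "fact p * (T (I, K) * F (coords p K, J)) = (fact p * T (I, K)) * F (coords p K, J)" by simp
    then show "(\<Sum>(a, b)\<in>words p \<times> words p. T (a, b) * (Orb a b I K * F (coords p K, J)))
        = fact p * (T (I, K) * F (coords p K, J))"
      by (simp only: TO[OF I K] sum.cartesian_product sum_distrib_right split_def mult.assoc)
  qed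
  finally show ?thesis by simp
qed

text \<open>
  The passage back from matrices to forms; being linear, it carries the span of the permutation
  matrices to the span of the permutation forms.
\<close>

definition form_of_matrix :: "nat \<Rightarrow> ((nat \<Rightarrow> 'v) \<times> (nat \<Rightarrow> 'v) \<Rightarrow> complex) \<Rightarrow> 'v args \<Rightarrow> complex" where
  "form_of_matrix p M = (\<lambda>(\<alpha>, w). if (\<alpha>, w) \<in> args scale p p
     then \<Sum>I\<in>words p. \<Sum>J\<in>words p. (\<Prod>i=1..p. \<alpha> i (I i)) * (\<Prod>j=1..p. coord (J j) (w j)) * M (I, J)
     else 0)"

lemma form_of_matrix_linear: "Vector_Spaces.linear form_scale form_scale (form_of_matrix p)"
  unfolding Vector_Spaces.linear_iff
  by (auto simp: vector_space_form_scale form_of_matrix_def form_scale_def fun_eq_iff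
      sum.distrib sum_distrib_left distrib_left mult.left_commute)

lemma multilinear_form_eq_form_of_matrix:
  assumes "F \<in> multilinear_forms scale p p"
    and "\<And>I J. I \<in> words p \<Longrightarrow> J \<in> words p \<Longrightarrow> F (coords p I, J) = M (I, J)"
  shows "F = form_of_matrix p M"
proof (rule ext, clarify)
  fix \<alpha> w
  show "F (\<alpha>, w) = form_of_matrix p M (\<alpha>, w)"
  proof (cases "(\<alpha>, w) \<in> args scale p p")
    case True
    have "F (\<alpha>, w) = (\<Sum>I\<in>words p. \<Sum>J\<in>words p.
        (\<Prod>i=1..p. \<alpha> i (I i)) * (\<Prod>j=1..p. coord (J j) (w j)) * M (I, J))"
      unfolding multilinear_form_expansion[OF assms(1) True]
      by (intro sum.cong refl) (simp add: assms(2))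
    then show ?thesis using True by (simp only: form_of_matrix_def case_prod_conv if_True)
  next
    case False
    then show ?thesis using assms(1) by (simp add: multilinear_forms_def form_of_matrix_def)
  qed
qed

text \<open>
  The first fundamental theorem of invariant theory for \<open>GL(V)\<close>: the matrix of an invariant form
  commutes with the commutant of the permutation action on words, so the double commutant theorem
  applies.
\<close>

theorem first_fundamental_theorem:
  "gl_invariants scale p p = form.span (perm_form p ` {\<sigma>. \<sigma> permutes {1..p}})"
proof
  show "form.span (perm_form p ` {\<sigma>. \<sigma> permutes {1..p}}) \<subseteq> gl_invariants scale p p"
    using perm_form_invariant by (intro form.span_minimal gl_invariants_subspace) auto
  show "gl_invariants scale p p \<subseteq> form.span (perm_form p ` {\<sigma>. \<sigma> permutes {1..p}})"
  proof
    fix F assume F: "F \<in> gl_invariants scale p p"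
    define M where "M = (\<lambda>(I, J). if I \<in> words p \<and> J \<in> words p then F (coords p I, J) else 0)"
    define G where "G = (\<lambda>\<sigma> (J :: nat \<Rightarrow> 'v). J \<circ> \<sigma>) ` {\<sigma>. \<sigma> permutes {1..p}}"
    have comp: "(\<lambda>J :: nat \<Rightarrow> 'v. J \<circ> \<sigma>) \<circ> (\<lambda>J. J \<circ> \<tau>) = (\<lambda>J. J \<circ> (\<tau> \<circ> \<sigma>))" for \<sigma> \<tau> :: "nat \<Rightarrow> nat"
      by (simp add: fun_eq_iff)
    have mem: "(\<lambda>J. J \<circ> \<sigma>) \<in> G" if "\<sigma> permutes {1..p}" for \<sigma> using that by (auto simp: G_def)
    have inverse: "bij (\<lambda>J :: nat \<Rightarrow> 'v. J \<circ> \<sigma>)" "inv (\<lambda>J :: nat \<Rightarrow> 'v. J \<circ> \<sigma>) = (\<lambda>J. J \<circ> inv \<sigma>)"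
      if "\<sigma> permutes {1..p}" for \<sigma>
    proof -
      have 1: "(\<lambda>J :: nat \<Rightarrow> 'v. J \<circ> \<sigma>) \<circ> (\<lambda>J. J \<circ> inv \<sigma>) = id" "(\<lambda>J :: nat \<Rightarrow> 'v. J \<circ> inv \<sigma>) \<circ> (\<lambda>J. J \<circ> \<sigma>) = id"
        unfolding comp using permutes_inv_o[OF that] by (simp_all add: fun_eq_iff)
      show "bij (\<lambda>J :: nat \<Rightarrow> 'v. J \<circ> \<sigma>)" by (rule o_bij[OF 1(2) 1(1)])
      show "inv (\<lambda>J :: nat \<Rightarrow> 'v. J \<circ> \<sigma>) = (\<lambda>J. J \<circ> inv \<sigma>)" by (rule inv_unique_comp[OF 1])
    qed
    have "M \<in> form.span (permutation_matrix (words p) ` G)"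
    proof (rule double_commutant_permutation_group)
      show "finite (words p)" by (rule finite_words)
      show "finite G" unfolding G_def by (intro finite_imageI finite_permutations) simp
      show "id \<in> G" using mem[OF permutes_id] by (simp add: id_def comp_def)
      show "bij g" if "g \<in> G" for g using that inverse(1) by (auto simp: G_def)
      show "inv g \<in> G" if "g \<in> G" for g
      proof -
        obtain \<sigma> where "\<sigma> permutes {1..p}" "g = (\<lambda>J. J \<circ> \<sigma>)" using \<open>g \<in> G\<close> by (auto simp: G_def)
        then show ?thesis using inverse(2)[of \<sigma>] mem[OF permutes_inv[of \<sigma>]] by simp
      qed
      show "g \<circ> h \<in> G" if "g \<in> G" "h \<in> G" for g h
        using that permutes_compose by (fastforce simp: G_def comp)
      show "g x \<in> words p \<longleftrightarrow> x \<in> words p" if "g \<in> G" for g x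
        using that word_compose_iff by (auto simp only: G_def)
      show "M (x, y) = 0" if "x \<notin> words p \<or> y \<notin> words p" for x y using that by (auto simp: M_def)
      fix T :: "(nat \<Rightarrow> 'v) \<times> (nat \<Rightarrow> 'v) \<Rightarrow> complex" and I J
      assume T: "\<And>g x y. g \<in> G \<Longrightarrow> T (g x, g y) = T (x, y)" and IJ: "I \<in> words p" "J \<in> words p"
      have "(\<Sum>K\<in>words p. F (coords p I, K) * T (K, J)) = (\<Sum>K\<in>words p. T (I, K) * F (coords p K, J))"
        by (rule gl_invariant_commutes_symmetric[OF F T[OF mem] IJ])
      then show "(\<Sum>z\<in>words p. M (I, z) * T (z, J)) = (\<Sum>z\<in>words p. T (I, z) * M (z, J))"
        using IJ by (simp add: M_def)
    qed
    moreover have "F = form_of_matrix p M"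
      using F by (intro multilinear_form_eq_form_of_matrix) (auto simp: gl_invariants_def tensor_space_eq M_def)
    ultimately have "F \<in> form_of_matrix p ` form.span (permutation_matrix (words p) ` G)" by simp
    also have "\<dots> = form.span (form_of_matrix p ` permutation_matrix (words p) ` G)"
    proof -
      interpret l: Vector_Spaces.linear form_scale form_scale "form_of_matrix p" by (rule form_of_matrix_linear)
      show ?thesis by (rule l.span_image[symmetric])
    qed
    also have "form_of_matrix p ` permutation_matrix (words p) ` G = perm_form p ` {\<sigma>. \<sigma> permutes {1..p}}"
    proof -
      have "perm_form p \<sigma> = form_of_matrix p (permutation_matrix (words p) (\<lambda>J. J \<circ> \<sigma>))"
        if "\<sigma> permutes {1..p}" for \<sigma>
        using that by (intro multilinear_form_eq_form_of_matrix perm_form_multilinear)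
          (auto simp: perm_form_coords permutation_matrix_def)
      then show ?thesis unfolding G_def image_image by (intro image_cong) auto
    qed
    finally show "F \<in> form.span (perm_form p ` {\<sigma>. \<sigma> permutes {1..p}})" .
  qed
qed

section \<open>Antisymmetrisers vanish and straighten diagrams\<close>

text \<open>
  At a pair of words \<open>(I, J)\<close>, the word \<open>I\<close> takes the same letter at two indices \<open>a, b \<in> S\<close>.  Then
  \<open>\<pi>\<close> and \<open>\<pi> \<circ> (a b)\<close> contribute the same matrix entry with opposite signs.
\<close>

lemma antisymmetriser_vanishes:
  assumes \<sigma>: "\<sigma> permutes {1..p}" and S: "S \<subseteq> {1..p}" and card: "card S > card Basis"
  shows "(\<Sum>\<pi> | \<pi> permutes S. form_scale (of_int (sign \<pi>)) (perm_form p (\<sigma> \<circ> \<pi>))) = 0"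
proof (rule multilinear_form_eqI)
  have finS: "finite S" using S finite_subset by blast
  have perm: "\<sigma> \<circ> \<pi> permutes {1..p}" if "\<pi> permutes S" for \<pi>
    using permutes_compose[OF permutes_subset[OF that S] \<sigma>] .
  have sub: "form.subspace (multilinear_forms scale p p)"
    by (rule multilinear_forms_subspace) (rule vector_space_axioms)
  show "(\<Sum>\<pi> | \<pi> permutes S. form_scale (of_int (sign \<pi>)) (perm_form p (\<sigma> \<circ> \<pi>))) \<in> multilinear_forms scale p p"
    by (intro form.subspace_sum[OF sub] form.subspace_scale[OF sub] perm_form_multilinear)
      (rule perm, simp)
  show "0 \<in> multilinear_forms scale p p" by (rule form.subspace_0[OF sub])
  fix I J assume I: "I \<in> words p" and J: "J \<in> words p"
  have "I ` S \<subseteq> Basis" using I S by (auto simp: PiE_iff)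
  then have "card (I ` S) \<le> card Basis" by (rule card_mono[OF finite_Basis])
  then have "\<not> inj_on I S" using card card_image[of I S] by auto
  then obtain a b where ab: "a \<in> S" "b \<in> S" "a \<noteq> b" "I a = I b" by (auto simp: inj_on_def)
  let ?t = "Transposition.transpose a b"
  let ?h = "\<lambda>\<pi>. of_int (sign \<pi>) * (if I = J \<circ> (\<sigma> \<circ> \<pi>) then 1 else 0 :: complex)"
  have t: "?t permutes S" using ab by (simp add: permutes_swap_id)
  have It: "I \<circ> ?t = I" using ab(4) by (auto simp: fun_eq_iff Transposition.transpose_def)
  have tt: "\<pi> \<circ> ?t \<circ> ?t = \<pi>" for \<pi> :: "nat \<Rightarrow> nat" by (simp add: o_assoc[symmetric])
  have "(\<Sum>\<pi> | \<pi> permutes S. ?h \<pi>) = (\<Sum>\<pi> | \<pi> permutes S. ?h (\<pi> \<circ> ?t))"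
    by (rule sum.reindex_bij_witness[where i = "\<lambda>\<pi>. \<pi> \<circ> ?t" and j = "\<lambda>\<pi>. \<pi> \<circ> ?t"])
       (simp_all only: tt mem_Collect_eq permutes_compose[OF t])
  also have "\<dots> = (\<Sum>\<pi> | \<pi> permutes S. - ?h \<pi>)"
  proof (rule sum.cong[OF refl])
    fix \<pi> assume "\<pi> \<in> {\<pi>. \<pi> permutes S}"
    then have "permutation \<pi>" using finS permutation_permutes by blast
    then have "sign (\<pi> \<circ> ?t) = sign \<pi> * sign ?t"
      using permutation_swap_id by (rule sign_compose)
    then have sign: "sign (\<pi> \<circ> ?t) = - sign \<pi>"
      using ab(3) by (simp add: sign_swap_id)
    have "I = J \<circ> (\<sigma> \<circ> (\<pi> \<circ> ?t)) \<longleftrightarrow> I = J \<circ> (\<sigma> \<circ> \<pi>)"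
    proof
      assume "I = J \<circ> (\<sigma> \<circ> (\<pi> \<circ> ?t))"
      then have "I \<circ> ?t = J \<circ> (\<sigma> \<circ> (\<pi> \<circ> ?t \<circ> ?t))" by (simp only: o_assoc)
      then show "I = J \<circ> (\<sigma> \<circ> \<pi>)" by (simp only: It tt)
    next
      assume "I = J \<circ> (\<sigma> \<circ> \<pi>)"
      then have "I \<circ> ?t = J \<circ> (\<sigma> \<circ> (\<pi> \<circ> ?t))" by (simp only: o_assoc)
      then show "I = J \<circ> (\<sigma> \<circ> (\<pi> \<circ> ?t))" by (simp only: It)
    qed
    then show "?h (\<pi> \<circ> ?t) = - ?h \<pi>" by (simp add: sign)
  qed
  also have "\<dots> = - (\<Sum>\<pi> | \<pi> permutes S. ?h \<pi>)" by (rule sum_negf)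
  finally have zero: "(\<Sum>\<pi> | \<pi> permutes S. ?h \<pi>) = 0" by simp
  have "(\<Sum>\<pi> | \<pi> permutes S. form_scale (of_int (sign \<pi>)) (perm_form p (\<sigma> \<circ> \<pi>))) (coords p I, J)
      = (\<Sum>\<pi> | \<pi> permutes S. ?h \<pi>)"
    unfolding sum_fun_apply form_scale_def
    by (rule sum.cong[OF refl]) (simp add: perm_form_coords[OF perm I J])
  then show "(\<Sum>\<pi> | \<pi> permutes S. form_scale (of_int (sign \<pi>)) (perm_form p (\<sigma> \<circ> \<pi>))) (coords p I, J)
      = 0 (coords p I, J)" using zero by simp
qed

text \<open>
  A lexicographically minimal counterexample \<open>\<tau>\<close> decreases on a set \<open>S0\<close> of more than \<open>dim V\<close>
  indices.  The vanishing antisymmetriser over \<open>S0\<close> expresses its form by those of \<open>\<tau> \<circ> \<pi>\<close> with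
  \<open>\<pi> \<noteq> id\<close>, which are smaller and hence no counterexamples.
\<close>

lemma perm_form_straightening:
  assumes "\<sigma> permutes {1..p}"
  shows "perm_form p \<sigma> \<in> form.span (perm_form p ` bounded_permutations (card Basis) p)"
proof (rule ccontr)
  let ?k = "card Basis"
  let ?W = "form.span (perm_form p ` bounded_permutations ?k p)"
  define C where "C = {\<tau>. \<tau> permutes {1..p} \<and> perm_form p \<tau> \<notin> ?W}"
  assume "perm_form p \<sigma> \<notin> ?W"
  then have "C \<noteq> {}" using assms by (auto simp: C_def)
  moreover have "finite C"
    by (rule finite_subset[OF _ finite_permutations[of "{1..p}"]]) (auto simp: C_def)
  moreover have "asymp_on C less_fun" by (rule asymp_onI) (rule less_fun_asym)
  moreover have "transp_on C less_fun" by (rule transp_onI) (rule less_fun_trans)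
  ultimately have "\<exists>\<tau>\<in>C. \<forall>\<rho>\<in>C. \<rho> \<noteq> \<tau> \<longrightarrow> \<not> less_fun \<rho> \<tau>"
    by (intro Finite_Set.bex_min_element)
  then obtain \<tau> where "\<tau> \<in> C" and min: "\<And>\<rho>. \<rho> \<in> C \<Longrightarrow> \<rho> \<noteq> \<tau> \<Longrightarrow> \<not> less_fun \<rho> \<tau>"
    by blast
  then have \<tau>: "\<tau> permutes {1..p}" "perm_form p \<tau> \<notin> ?W" by (simp_all add: C_def)
  have "\<tau> \<notin> bounded_permutations ?k p"
    using \<tau>(2) form.span_base[OF imageI, of \<tau> _ "perm_form p"] by metis
  then obtain S0 where S0: "S0 \<subseteq> {1..p}" "strict_antimono_on S0 \<tau>" "?k < card S0"
    using \<tau>(1) unfolding bounded_permutations_def mem_Collect_eq by (metis not_le)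
  have finS: "finite S0" using S0(1) finite_subset by blast
  have rest: "perm_form p (\<tau> \<circ> \<pi>) \<in> ?W" if \<pi>: "\<pi> permutes S0" "\<pi> \<noteq> id" for \<pi>
  proof -
    have "less_fun (\<tau> \<circ> \<pi>) \<tau>" by (rule less_fun_rearranged_antimono[OF \<pi> S0(2)])
    moreover from this have "\<tau> \<circ> \<pi> \<noteq> \<tau>" by (auto simp: less_fun_irrefl)
    moreover have "\<tau> \<circ> \<pi> permutes {1..p}"
      using permutes_compose[OF permutes_subset[OF \<pi>(1) S0(1)] \<tau>(1)] .
    ultimately show ?thesis using min[of "\<tau> \<circ> \<pi>"] by (auto simp: C_def)
  qed
  let ?term = "\<lambda>\<pi>. form_scale (of_int (sign \<pi>)) (perm_form p (\<tau> \<circ> \<pi>))"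
  have "(\<Sum>\<pi> | \<pi> permutes S0. ?term \<pi>) = ?term id + (\<Sum>\<pi>\<in>{\<pi>. \<pi> permutes S0} - {id}. ?term \<pi>)"
    by (rule sum.remove) (simp_all add: finS finite_permutations)
  then have "?term id + (\<Sum>\<pi>\<in>{\<pi>. \<pi> permutes S0} - {id}. ?term \<pi>) = 0"
    using antisymmetriser_vanishes[OF \<tau>(1) S0(1,3)] by simp
  then have "perm_form p \<tau> = - (\<Sum>\<pi>\<in>{\<pi>. \<pi> permutes S0} - {id}. ?term \<pi>)"
    by (simp add: eq_neg_iff_add_eq_0)
  also have "\<dots> \<in> ?W"
  proof (intro form.span_neg form.span_sum form.span_scale)
    fix \<pi> assume "\<pi> \<in> {\<pi>. \<pi> permutes S0} - {id}"
    then show "perm_form p (\<tau> \<circ> \<pi>) \<in> ?W" using rest by blast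
  qed
  finally show False using \<tau>(2) by contradiction
qed

section \<open>Linear independence\<close>

text \<open>
  The point \<open>(coords p I, I \<circ> inv \<sigma>)\<close>, where \<open>I\<close> spells out the colouring of \<open>\<sigma>\<close> with a different
  basis vector for each colour.
\<close>

lemma separating_point:
  assumes "\<sigma> \<in> bounded_permutations (card Basis) p"
  shows "\<exists>x. perm_form p \<sigma> x = 1 \<and>
             (\<forall>\<tau>. \<tau> permutes {1..p} \<longrightarrow> \<tau> \<noteq> \<sigma> \<longrightarrow> \<not> less_fun \<sigma> \<tau> \<longrightarrow> perm_form p \<tau> x = 0)"
proof -
  have \<sigma>: "\<sigma> permutes {1..p}" using assms by (simp add: bounded_permutations_def)
  obtain c where c: "c \<in> {1..p} \<rightarrow> {1..card Basis}"
    and incr: "\<And>i j. i \<in> {1..p} \<Longrightarrow> j \<in> {1..p} \<Longrightarrow> c i = c j \<Longrightarrow> i < j \<Longrightarrow> \<sigma> i < \<sigma> j"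
    using bounded_permutation_colouring[OF assms] by blast
  obtain e where e: "bij_betw e {1..card Basis} Basis"
    using ex_bij_betw_nat_finite_1[OF finite_Basis] by blast
  define I where "I = (\<lambda>i\<in>{1..p}. e (c i))"
  have I: "I \<in> words p" using c e by (auto simp: I_def bij_betw_def)
  have I_eq: "c i = c j" if "I i = I j" "i \<in> {1..p}" "j \<in> {1..p}" for i j
  proof -
    have "c i \<in> {1..card Basis}" "c j \<in> {1..card Basis}" using c that(2,3) by auto
    then show ?thesis using that e by (auto simp: I_def bij_betw_def dest: inj_onD)
  qed
  have J: "I \<circ> inv \<sigma> \<in> words p" using word_compose_iff[OF permutes_inv[OF \<sigma>]] I by blast
  have "perm_form p \<sigma> (coords p I, I \<circ> inv \<sigma>) = 1"
    using permutes_inv_o[OF \<sigma>] by (simp add: perm_form_coords[OF \<sigma> I J] o_assoc[symmetric])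
  moreover have "perm_form p \<tau> (coords p I, I \<circ> inv \<sigma>) = 0"
    if \<tau>: "\<tau> permutes {1..p}" "\<tau> \<noteq> \<sigma>" "\<not> less_fun \<sigma> \<tau>" for \<tau>
  proof -
    have "I \<noteq> (I \<circ> inv \<sigma>) \<circ> \<tau>"
    proof
      assume eq: "I = (I \<circ> inv \<sigma>) \<circ> \<tau>"
      have "c (inv \<sigma> (\<tau> i)) = c i" if i: "i \<in> {1..p}" for i
      proof (rule I_eq)
        show "I (inv \<sigma> (\<tau> i)) = I i" using fun_cong[OF eq, of i] by simp
        have "\<tau> i \<in> {1..p}" using i permutes_in_image[OF \<tau>(1)] by blast
        then show "inv \<sigma> (\<tau> i) \<in> {1..p}" using permutes_in_image[OF permutes_inv[OF \<sigma>]] by blast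
      qed (rule i)
      then have "less_fun \<sigma> \<tau>" using less_fun_if_same_colours[OF \<sigma> \<tau>(1) incr _ \<tau>(2)] by blast
      then show False using \<tau>(3) by contradiction
    qed
    then show ?thesis by (simp add: perm_form_coords[OF \<tau>(1) I J])
  qed
  ultimately show ?thesis by blast
qed

lemma perm_form_inj_on: "inj_on (perm_form p) (bounded_permutations (card Basis) p)"
proof (rule inj_onI, rule ccontr)
  fix \<sigma> \<tau> assume \<sigma>\<tau>: "\<sigma> \<in> bounded_permutations (card Basis) p" "\<tau> \<in> bounded_permutations (card Basis) p"
    and eq: "perm_form p \<sigma> = perm_form p \<tau>" and "\<sigma> \<noteq> \<tau>"
  have "less_fun \<rho> \<rho>'"
    if "\<rho> \<in> bounded_permutations (card Basis) p" "\<rho>' \<in> bounded_permutations (card Basis) p"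
      "perm_form p \<rho> = perm_form p \<rho>'" "\<rho> \<noteq> \<rho>'" for \<rho> \<rho>'
    using separating_point[OF that(1)] that(2-4) by (auto simp: bounded_permutations_def)
  then show False using \<sigma>\<tau> eq \<open>\<sigma> \<noteq> \<tau>\<close> less_fun_asym by metis
qed

text \<open>
  In a nontrivial relation, evaluate at the separating point of the lexicographically largest
  permutation that occurs: all other terms vanish there.
\<close>

lemma perm_form_independent:
  "form.independent (perm_form p ` bounded_permutations (card Basis) p)"
proof -
  let ?B = "bounded_permutations (card Basis) p"
  have fin: "finite ?B"
    by (rule finite_subset[OF _ finite_permutations[of "{1..p}"]]) (auto simp: bounded_permutations_def)
  have zero: "\<forall>\<sigma>\<in>?B. u \<sigma> = 0" if sum: "(\<Sum>\<sigma>\<in>?B. form_scale (u \<sigma>) (perm_form p \<sigma>)) = 0" for u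
  proof (rule ccontr)
    define C where "C = {\<sigma> \<in> ?B. u \<sigma> \<noteq> 0}"
    assume "\<not> (\<forall>\<sigma>\<in>?B. u \<sigma> = 0)"
    then have "C \<noteq> {}" by (auto simp: C_def)
    moreover have "finite C" using fin by (simp add: C_def)
    moreover have "asymp_on C (\<lambda>\<sigma> \<tau>. less_fun \<tau> \<sigma>)" by (rule asymp_onI) (rule less_fun_asym)
    moreover have "transp_on C (\<lambda>\<sigma> \<tau>. less_fun \<tau> \<sigma>)"
      by (rule transp_onI) (rule less_fun_trans)
    ultimately have "\<exists>\<sigma>\<in>C. \<forall>\<tau>\<in>C. \<tau> \<noteq> \<sigma> \<longrightarrow> \<not> less_fun \<sigma> \<tau>"
      by (intro Finite_Set.bex_min_element)
    then obtain \<sigma> where "\<sigma> \<in> C" and max: "\<And>\<tau>. \<tau> \<in> C \<Longrightarrow> \<tau> \<noteq> \<sigma> \<Longrightarrow> \<not> less_fun \<sigma> \<tau>"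
      by blast
    then have \<sigma>: "\<sigma> \<in> ?B" "u \<sigma> \<noteq> 0" by (simp_all add: C_def)
    obtain x where x: "perm_form p \<sigma> x = 1"
      and vanish: "\<And>\<tau>. \<tau> permutes {1..p} \<Longrightarrow> \<tau> \<noteq> \<sigma> \<Longrightarrow> \<not> less_fun \<sigma> \<tau> \<Longrightarrow> perm_form p \<tau> x = 0"
      using separating_point[OF \<sigma>(1)] by blast
    have "0 = (\<Sum>\<tau>\<in>?B. u \<tau> * perm_form p \<tau> x)"
      using fun_cong[OF sum, of x] by (simp add: sum_fun_apply form_scale_def)
    also have "\<dots> = (\<Sum>\<tau>\<in>?B. if \<tau> = \<sigma> then u \<sigma> else 0)"
    proof (rule sum.cong[OF refl])
      fix \<tau> assume \<tau>: "\<tau> \<in> ?B"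
      show "u \<tau> * perm_form p \<tau> x = (if \<tau> = \<sigma> then u \<sigma> else 0)"
        using x vanish[of \<tau>] max[of \<tau>] \<tau> by (auto simp: bounded_permutations_def C_def)
    qed
    also have "\<dots> = u \<sigma>" using fin \<sigma>(1) by simp
    finally show False using \<sigma>(2) by simp
  qed
  show ?thesis
  proof (rule form.independent_if_scalars_zero)
    show "finite (perm_form p ` ?B)" using fin by simp
    fix f F assume sum: "(\<Sum>G\<in>perm_form p ` ?B. form_scale (f G) G) = 0" and F: "F \<in> perm_form p ` ?B"
    have "(\<Sum>\<sigma>\<in>?B. form_scale (f (perm_form p \<sigma>)) (perm_form p \<sigma>)) = 0"
      using sum by (simp add: sum.reindex[OF perm_form_inj_on])
    then show "f F = 0" using zero[of "\<lambda>\<sigma>. f (perm_form p \<sigma>)"] F by blast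
  qed
qed

theorem span_bounded_perm_forms:
  "form.span (perm_form p ` bounded_permutations (card Basis) p) = gl_invariants scale p p"
proof
  show "form.span (perm_form p ` bounded_permutations (card Basis) p) \<subseteq> gl_invariants scale p p"
    unfolding first_fundamental_theorem
    by (intro form.span_mono image_mono) (auto simp: bounded_permutations_def)
  show "gl_invariants scale p p \<subseteq> form.span (perm_form p ` bounded_permutations (card Basis) p)"
    unfolding first_fundamental_theorem
    using perm_form_straightening by (intro form.span_minimal form.subspace_span) auto
qed

end

lemma id_bounded_permutation:
  assumes "k \<ge> 1"
  shows "id \<in> bounded_permutations k p"
proof -
  have "card S \<le> k" if S: "S \<subseteq> {1..p}" "strict_antimono_on S id" for S :: "nat set"
  proof -
    have "i = j" if "i \<in> S" "j \<in> S" for i j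
      using S(2) that by (cases i j rule: linorder_cases) (auto simp: monotone_on_def)
    moreover have "finite S" using S(1) finite_subset by blast
    ultimately have "card S \<le> 1" using card_le_Suc0_iff_eq[of S] by auto
    then show ?thesis using assms by simp
  qed
  then show ?thesis by (simp add: bounded_permutations_def permutes_id)
qed

theorem proposition4p1p2:
  fixes scale :: "complex \<Rightarrow> 'v::ab_group_add \<Rightarrow> 'v" and Basis :: "'v set" and k p q :: nat
  assumes "finite_dimensional_vector_space scale Basis"
    and "vector_space.dim scale (UNIV :: 'v set) = k"
  shows "(k \<ge> 1 \<longrightarrow> (gl_invariants scale p q \<noteq> {0} \<longleftrightarrow> p = q)) \<and>
         inj_on (diagram_form scale p) (nesting_bounded_diagrams k p) \<and>
         \<not> module.dependent form_scale (diagram_form scale p ` nesting_bounded_diagrams k p) \<and>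
         module.span form_scale (diagram_form scale p ` nesting_bounded_diagrams k p)
           = gl_invariants scale p p"
proof -
  interpret V: finite_dimensional_complex_space scale Basis
    unfolding finite_dimensional_complex_space_def by (rule assms(1))
  have k: "k = card Basis" using assms(2) by simp
  have image: "diagram_form scale p ` nesting_bounded_diagrams k p
      = V.perm_form p ` bounded_permutations k p"
    unfolding nesting_bounded_diagrams_eq image_image ..
  have indep: "form.independent (diagram_form scale p ` nesting_bounded_diagrams k p)"
    unfolding image unfolding k by (rule V.perm_form_independent)
  have span: "form.span (diagram_form scale p ` nesting_bounded_diagrams k p) = gl_invariants scale p p"
    unfolding image unfolding k by (rule V.span_bounded_perm_forms)
  have inj: "inj_on (diagram_form scale p) (nesting_bounded_diagrams k p)"
    unfolding nesting_bounded_diagrams_eq unfolding k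
    using V.perm_form_inj_on by (auto intro!: inj_onI dest: inj_onD)
  have "gl_invariants scale p q \<noteq> {0} \<longleftrightarrow> p = q" if "k \<ge> 1"
  proof
    assume "p = q"
    have "V.perm_form p id \<in> V.perm_form p ` bounded_permutations k p"
      using id_bounded_permutation[OF that] by (rule imageI)
    then have "V.perm_form p id \<noteq> 0" "V.perm_form p id \<in> gl_invariants scale p p"
      using form.dependent_zero indep form.span_base span unfolding image by metis+
    then show "gl_invariants scale p q \<noteq> {0}" using \<open>p = q\<close> by auto
  qed (use V.gl_invariants_eq_zero_if_degrees_differ in blast)
  then show ?thesis using inj indep span by blast
qed


end
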